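(* Let $\delta_1<\delta_2$ be real, let $\mathcal Y_m$ be a set of $m$ distinct points in $(\delta_1,\delta_2)$, let $c\in(0,1)$, and let $\rho_{[i]}(\tau,c)$ be the relative density of the subdigraph $D_{[i]}(\tau,c)$ of the central similarity proximity catch digraph based on uniform data in $(\delta_1,\delta_2)$. Then for $\tau\in(0,\infty)$, as $n_i\to\infty$, we have: (i) for $i\in\{2,\dots,m\}$, $\sqrt{n_i}\,[\rho_{[i]}(\tau,c)-\mu(\tau,c)]\to\mathcal N(0,4\,\nu(\tau,c))$ in law, where $\mu(\tau,c)=\mathbf E[\rho_{[i]}(\tau,c)]$ is the arc probability and $\nu(\tau,c)=\mathbf{Cov}[h_{12},h_{13}]$ in the middle intervals; (ii) for $i\in\{1,m+1\}$, $\sqrt{n_i}\,[\rho_{[i]}(\tau,c)-\mu_e(\tau)]\to\mathcal N(0,4\,\nu_e(\tau))$ in law, where $\mu_e(\tau)=\mathbf E[\rho_{[i]}(\tau,c)]$ is the arc probability and $\nu_e(\tau)=\mathbf{Cov}[h_{12},h_{13}]$ in the end intervals.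
   Context: $\mathcal N(\mu,\sigma^2)$ is the normal distribution with mean $\mu$ and variance $\sigma^2$. $y_{(1)}<\dots<y_{(m)}$ are the ordered points of $\mathcal Y_m$, $y_{(0)}:=\delta_1$, $y_{(m+1)}:=\delta_2$, $\mathcal I_i:=(y_{(i-1)},y_{(i)})$. $\mathcal X_n$ is an iid sample from the uniform distribution on $(\delta_1,\delta_2)$, $\mathcal X_{[i]}:=\mathcal X_n\cap\mathcal I_i$, $n_i:=|\mathcal X_{[i]}|$. Given $n_i$, the points of $\mathcal X_{[i]}$ are $n_i$ iid uniform points on $\mathcal I_i$, and the limits as $n_i\to\infty$ are for $\rho_{[i]}$ built on $n_i$ such points. Central similarity proximity regions. For $x$ in a middle interval $\mathcal I_i$ ($2\le i\le m$), with $M_c=y_{(i-1)}+c(y_{(i)}-y_{(i-1)})$: $$N(x,\tau,c)=\begin{cases}\left(x-\tau(x-y_{(i-1)}),\,x+\frac{\tau(1-c)(x-y_{(i-1)})}{c}\right)\cap\mathcal I_i & x\in(y_{(i-1)},M_c),\\ \left(x-\frac{c\tau(y_{(i)}-x)}{1-c},\,x+\tau(y_{(i)}-x)\right)\cap\mathcal I_i & x\in(M_c,y_{(i)}),\end{cases}$$ and at $x=M_c$ arbitrarily one of the two expressions. For $x$ in an end interval: $N_e(x,\tau)=(x-\tau(y_{(1)}-x),\,x+\tau(y_{(1)}-x))\cap\mathcal I_1$ if $x\in\mathcal I_1$, and $N_e(x,\tau)=(x-\tau(x-y_{(m)}),\,x+\tau(x-y_{(m)}))\cap\mathcal I_{m+1}$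 if $x\in\mathcal I_{m+1}$. $D_{[i]}(\tau,c)$ is the digraph on $\mathcal X_{[i]}$ with an arc $(X_j,X_k)$, for distinct $X_j,X_k$, iff $X_k$ lies in the proximity region ($N(X_j,\tau,c)$ for middle intervals, $N_e(X_j,\tau)$ for end intervals) of $X_j$; $\rho_{[i]}(\tau,c)$ is its number of arcs divided by $n_i(n_i-1)$. For iid uniform points $X_1,X_2,X_3$ on $\mathcal I_i$, let $g_{jk}$ be the indicator that $X_k$ lies in the proximity region of $X_j$, and $h_{jk}=(g_{jk}+g_{kj})/2$. The arc probability is $P(X_2\in N(X_1,\tau,c))$ for middle intervals and $P(X_2\in N_e(X_1,\tau))$ for end intervals. These quantities do not depend on which middle (respectively end) interval is used. *)

theory Defs
  imports "HOL-Probability.Probability" "Graph_Theory.Pair_Digraph"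
begin

definition ordered_point :: "real \<Rightarrow> real \<Rightarrow> real set \<Rightarrow> nat \<Rightarrow> real" where
  "ordered_point \<delta>1 \<delta>2 Y i =
     (if i = 0 then \<delta>1
      else if i \<le> card Y then sorted_list_of_set Y ! (i - 1)
      else \<delta>2)"

definition cell :: "real \<Rightarrow> real \<Rightarrow> real set \<Rightarrow> nat \<Rightarrow> real set" where
  "cell \<delta>1 \<delta>2 Y i = {ordered_point \<delta>1 \<delta>2 Y (i - 1)<..<ordered_point \<delta>1 \<delta>2 Y i}"

text \<open>
  Proximity regions in a cell \<open>(a, b)\<close>. In a middle cell the two formulas agree at the
  division point \<open>a + c * (b - a)\<close>, so assigning that point to the first one is no loss.
  The left end cell has its \<open>Y\<close>-point at \<open>b\<close>, the right end cell at \<open>a\<close>.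
\<close>

definition cs_region_middle :: "real \<Rightarrow> real \<Rightarrow> real \<Rightarrow> real \<Rightarrow> real \<Rightarrow> real set" where
  "cs_region_middle a b \<tau> c x =
     (if x \<le> a + c * (b - a)
      then {x - \<tau> * (x - a)<..<x + \<tau> * (1 - c) * (x - a) / c}
      else {x - c * \<tau> * (b - x) / (1 - c)<..<x + \<tau> * (b - x)}) \<inter> {a<..<b}"

definition cs_region_left_end :: "real \<Rightarrow> real \<Rightarrow> real \<Rightarrow> real \<Rightarrow> real set" where
  "cs_region_left_end a b \<tau> x = {x - \<tau> * (b - x)<..<x + \<tau> * (b - x)} \<inter> {a<..<b}"

definition cs_region_right_end :: "real \<Rightarrow> real \<Rightarrow> real \<Rightarrow> real \<Rightarrow> real set" where
  "cs_region_right_end a b \<tau> x = {x - \<tau> * (x - a)<..<x + \<tau> * (x - a)} \<inter> {a<..<b}"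

definition cs_region ::
    "real \<Rightarrow> real \<Rightarrow> real set \<Rightarrow> real \<Rightarrow> real \<Rightarrow> nat \<Rightarrow> real \<Rightarrow> real set" where
  "cs_region \<delta>1 \<delta>2 Y \<tau> c i =
     (let a = ordered_point \<delta>1 \<delta>2 Y (i - 1); b = ordered_point \<delta>1 \<delta>2 Y i in
      if i = 1 then cs_region_left_end a b \<tau>
      else if i = card Y + 1 then cs_region_right_end a b \<tau>
      else cs_region_middle a b \<tau> c)"

definition proximity_digraph :: "('a \<Rightarrow> 'a set) \<Rightarrow> 'a set \<Rightarrow> 'a pair_pre_digraph" where
  "proximity_digraph N V =
     \<lparr> pverts = V, parcs = {(u, v). u \<in> V \<and> v \<in> V \<and> u \<noteq> v \<and> v \<in> N u} \<rparr>"

definition relative_density :: "'a pair_pre_digraph \<Rightarrow> real" where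
  "relative_density G =
     real (card (parcs G)) / (real (card (pverts G)) * (real (card (pverts G)) - 1))"

text \<open>The relative density of the subdigraph on the first \<open>n\<close> points of a sequence in cell \<open>i\<close>.\<close>

definition cs_density ::
    "real \<Rightarrow> real \<Rightarrow> real set \<Rightarrow> real \<Rightarrow> real \<Rightarrow> nat \<Rightarrow> (nat \<Rightarrow> real) \<Rightarrow> nat \<Rightarrow> real" where
  "cs_density \<delta>1 \<delta>2 Y \<tau> c i x n =
     relative_density (proximity_digraph (cs_region \<delta>1 \<delta>2 Y \<tau> c i) (x ` {..<n}))"

definition sym_arc :: "('a \<Rightarrow> 'a set) \<Rightarrow> 'a \<Rightarrow> 'a \<Rightarrow> real" where
  "sym_arc N x y = (indicator (N x) y + indicator (N y) x) / 2"

definition covariance :: "'a measure \<Rightarrow> ('a \<Rightarrow> real) \<Rightarrow> ('a \<Rightarrow> real) \<Rightarrow> real" where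
  "covariance M f g =
     (LINT \<omega>|M. (f \<omega> - (LINT \<omega>'|M. f \<omega>')) * (g \<omega> - (LINT \<omega>'|M. g \<omega>')))"

definition arc_prob :: "'a measure \<Rightarrow> ('a \<Rightarrow> 'a set) \<Rightarrow> real" where
  "arc_prob U N = measure (U \<Otimes>\<^sub>M U) {(x1, x2) \<in> space (U \<Otimes>\<^sub>M U). x2 \<in> N x1}"

definition arc_cov :: "'a measure \<Rightarrow> ('a \<Rightarrow> 'a set) \<Rightarrow> real" where
  "arc_cov U N = covariance (U \<Otimes>\<^sub>M U \<Otimes>\<^sub>M U)
     (\<lambda>(x1, x2, x3). sym_arc N x1 x2) (\<lambda>(x1, x2, x3). sym_arc N x1 x3)"

text \<open>
  The parameters do not depend on the cell; they are defined on the reference cell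
  \<open>(0, 1)\<close>, taken as a left end cell for the two end parameters.
\<close>

abbreviation uniform_unit :: "real measure" where
  "uniform_unit \<equiv> uniform_measure lborel {0<..<1}"

definition cs_mu :: "real \<Rightarrow> real \<Rightarrow> real" where
  "cs_mu \<tau> c = arc_prob uniform_unit (cs_region_middle 0 1 \<tau> c)"

definition cs_nu :: "real \<Rightarrow> real \<Rightarrow> real" where
  "cs_nu \<tau> c = arc_cov uniform_unit (cs_region_middle 0 1 \<tau> c)"

definition cs_mu_end :: "real \<Rightarrow> real" where
  "cs_mu_end \<tau> = arc_prob uniform_unit (cs_region_left_end 0 1 \<tau>)"

definition cs_nu_end :: "real \<Rightarrow> real" where
  "cs_nu_end \<tau> = arc_cov uniform_unit (cs_region_left_end 0 1 \<tau>)"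

end

theory Submission
  imports Defs
begin

text \<open>
  An affine map carries a cell, its proximity regions and the uniform law to the reference cell
  \<open>(0, 1)\<close>, the right end cell being reflected. There the relative density is almost surely
  the U-statistic of order two with kernel \<open>h = sym_arc N\<close>. With \<open>h1 x = E h(x, X)\<close> and mean
  \<open>\<mu>\<close>, the centred U-statistic splits into \<open>2/n\<close> times the sum of the \<open>h1(X_i) - \<mu>\<close>, to which
  the central limit theorem applies, and a degenerate remainder whose terms are uncorrelated, so
  that it vanishes in L2 even after multiplication by \<open>sqrt n\<close>. The variance of \<open>h1(X)\<close> is
  \<open>Cov[h12, h13]\<close>. The limit is a genuine normal law because this variance is positive: close to
  a \<open>Y\<close>-point of the cell, \<open>h1\<close> is an affine function with nonzero slope.
\<close>

section \<open>Weak convergence under vanishing perturbations\<close>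

text \<open>Limits in law are handled through characteristic functions: adding \<open>B\<close>
  changes the one at \<open>t\<close> by at most \<bar>t\<bar> times the mean of \<bar>B\<bar>, so
  the remainder only has to vanish in L1. The factor 4 in the limit variance arises because both
  arguments of the kernel contribute the same projection.

  Two obstacles shape the rest. The vertices of the digraph form a set, so coinciding observations
  would merge into one vertex; this is why the density is a U-statistic only almost surely and why
  its measurability needs its own argument. Moreover \<open>normal_density 0 0\<close> is
  identically zero, so with variance zero the stated limit would not even be a probability measure.
  On the reference cell the projection at x is half the length of the region of x plus half the
  length of the set of points whose region contains x. Clipping at the cell boundary gives both
  lengths many cases in x; looking only next to a Y-point leaves a single alternative, whether
  regions there reach the Y-point (\<tau> \<ge> 1) or not.\<close>

lemma char_distr_mult:
  assumes [measurable_cong]: "sets N = sets borel"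
  shows "char (distr N borel (\<lambda>x. s * x)) t = char N (s * t)"
  unfolding char_def by (subst integral_distr) (auto simp: mult_ac)

text \<open>Rescaling a law rescales the argument of its characteristic function, so Levy continuity
  carries it through the limit.\<close>

lemma weak_conv_m_distr_mult:
  assumes N: "\<And>n. real_distribution (N n)" and \<mu>: "real_distribution \<mu>" and "weak_conv_m N \<mu>"
  shows "weak_conv_m (\<lambda>n. distr (N n) borel (\<lambda>x. s * x)) (distr \<mu> borel (\<lambda>x. s * x))"
proof (rule levy_continuity)
  interpret N: real_distribution "N n" for n by fact
  interpret \<mu>: real_distribution \<mu> by fact
  show "real_distribution (distr (N n) borel (\<lambda>x. s * x))" for n
    by (rule N.real_distribution_distr) simp
  show "real_distribution (distr \<mu> borel (\<lambda>x. s * x))"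
    by (rule \<mu>.real_distribution_distr) simp
  show "(\<lambda>n. char (distr (N n) borel (\<lambda>x. s * x)) t) \<longlonglongrightarrow> char (distr \<mu> borel (\<lambda>x. s * x)) t" for t
    using levy_continuity1[OF assms] by (simp add: char_distr_mult)
qed

lemma distr_std_normal_mult:
  assumes "0 < s"
  shows "distr std_normal_distribution borel (\<lambda>x. s * x) = density lborel (normal_density 0 s)"
proof -
  interpret N: prob_space std_normal_distribution
    by (rule prob_space_normal_density) simp
  have "distributed std_normal_distribution lborel (\<lambda>x. x) (\<lambda>x. ennreal (std_normal_density x))"
    by (auto simp: distributed_def distr_id2)
  from N.normal_density_affine[OF this _ , of s 0] assms
  have "distributed std_normal_distribution lborel (\<lambda>x. s * x) (\<lambda>x. ennreal (normal_density 0 s x))"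
    by simp
  then have "distr std_normal_distribution lborel (\<lambda>x. s * x) = density lborel (normal_density 0 s)"
    by (simp add: distributed_def)
  moreover have "distr std_normal_distribution lborel (\<lambda>x. s * x)
      = distr std_normal_distribution borel (\<lambda>x. s * x)"
    by (rule distr_cong) auto
  ultimately show ?thesis by simp
qed

text \<open>Factoring out the unimodular \<open>iexp b\<close> leaves the Taylor estimate of order
  zero at \<open>a - b\<close>.\<close>

lemma norm_iexp_diff_le: "norm (iexp a - iexp b) \<le> \<bar>a - b\<bar>"
proof -
  have "iexp a - iexp b = iexp b * (iexp (a - b) - 1)"
    by (simp add: algebra_simps exp_diff)
  then have "norm (iexp a - iexp b) = norm (iexp (a - b) - 1)"
    by (simp add: norm_mult)
  also have "\<dots> \<le> \<bar>a - b\<bar>"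
    using iexp_approx1[of "a - b" 0] by simp
  finally show ?thesis .
qed

text \<open>Slutsky's lemma with the remainder measured in L1, the norm that the second-moment
  estimate of the degenerate part controls. \<open>A n\<close> and \<open>B n\<close> may be
  dependent; in the application both are functions of the same sample.\<close>

lemma (in prob_space) weak_conv_m_add_vanishing:
  fixes A B :: "nat \<Rightarrow> 'a \<Rightarrow> real"
  assumes [measurable]: "\<And>n. random_variable borel (A n)"
    and B: "\<And>n. integrable M (B n)"
    and conv: "weak_conv_m (\<lambda>n. distr M borel (A n)) \<mu>" and \<mu>: "real_distribution \<mu>"
    and lim: "(\<lambda>n. expectation (\<lambda>\<omega>. \<bar>B n \<omega>\<bar>)) \<longlonglongrightarrow> 0"
  shows "weak_conv_m (\<lambda>n. distr M borel (\<lambda>\<omega>. A n \<omega> + B n \<omega>)) \<mu>"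
proof (rule levy_continuity)
  have [measurable]: "random_variable borel (B n)" for n
    using B by simp
  show "real_distribution (distr M borel (\<lambda>\<omega>. A n \<omega> + B n \<omega>))" for n
    by (rule real_distribution_distr) simp
  fix t
  let ?d = "\<lambda>n. char (distr M borel (\<lambda>\<omega>. A n \<omega> + B n \<omega>)) t - char (distr M borel (A n)) t"
  have "norm (?d n) \<le> \<bar>t\<bar> * expectation (\<lambda>\<omega>. \<bar>B n \<omega>\<bar>)" for n
  proof -
    have "?d n = (CLINT \<omega>|M. iexp (t * (A n \<omega> + B n \<omega>)) - iexp (t * A n \<omega>))"
      unfolding char_def
      by (subst (1 2) integral_distr)
         (auto intro!: Bochner_Integration.integral_diff[symmetric] integrable_iexp)
    also have "norm \<dots> \<le> (\<integral>\<omega>. norm (iexp (t * (A n \<omega> + B n \<omega>)) - iexp (t * A n \<omega>)) \<partial>M)"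
      by (rule integral_norm_bound)
    also have "\<dots> \<le> (\<integral>\<omega>. \<bar>t\<bar> * \<bar>B n \<omega>\<bar> \<partial>M)"
    proof (rule integral_mono)
      show "integrable M (\<lambda>\<omega>. norm (iexp (t * (A n \<omega> + B n \<omega>)) - iexp (t * A n \<omega>)))"
        by (intro integrable_norm Bochner_Integration.integrable_diff integrable_iexp) auto
      show "integrable M (\<lambda>\<omega>. \<bar>t\<bar> * \<bar>B n \<omega>\<bar>)"
        using B by simp
      show "norm (iexp (t * (A n \<omega> + B n \<omega>)) - iexp (t * A n \<omega>)) \<le> \<bar>t\<bar> * \<bar>B n \<omega>\<bar>" for \<omega>
        using norm_iexp_diff_le[of "t * (A n \<omega> + B n \<omega>)" "t * A n \<omega>"]
        by (simp add: distrib_left abs_mult)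
    qed
    finally show ?thesis by simp
  qed
  then have "?d \<longlonglongrightarrow> 0"
    using tendsto_mult_left[OF lim, of "\<bar>t\<bar>"]
    by (intro Lim_null_comparison[where f="?d" and g="\<lambda>n. \<bar>t\<bar> * expectation (\<lambda>\<omega>. \<bar>B n \<omega>\<bar>)"]
        always_eventually allI) simp_all
  moreover have "(\<lambda>n. char (distr M borel (A n)) t) \<longlonglongrightarrow> char \<mu> t"
    by (intro levy_continuity1 conv \<mu> real_distribution_distr) simp
  ultimately show "(\<lambda>n. char (distr M borel (\<lambda>\<omega>. A n \<omega> + B n \<omega>)) t) \<longlonglongrightarrow> char \<mu> t"
    using tendsto_add by fastforce
qed (fact \<mu>)

section \<open>Central limit theorem for U-statistics of order two\<close>

locale iid_sample = prob_space M for M :: "'a measure" +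
  fixes X :: "nat \<Rightarrow> 'a \<Rightarrow> real" and U :: "real measure"
  assumes indep: "indep_vars (\<lambda>_. borel) X UNIV"
    and distr_X: "\<And>j. distr M borel (X j) = U"
begin

lemma X_measurable [measurable]: "X j \<in> borel_measurable M"
  using indep unfolding indep_vars_def2 by simp

lemma sets_U [simp, measurable_cong]: "sets U = sets borel"
  using distr_X[of 0] by auto

lemma space_U [simp]: "space U = UNIV"
  using distr_X[of 0] by auto

sublocale U: prob_space U
  using distr_X[of 0] prob_space_distr[OF X_measurable] by metis

text \<open>Independence of disjoint blocks of coordinates, pushed forward along \<open>f\<close>
  and \<open>g\<close>. With blocks in place of single coordinates, the laws of pairs and triples
  and the integration of one point against all others come from one factorisation.\<close>

lemma distr_pair_restrict:
  assumes "A \<inter> B = {}"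
    and f [measurable]: "f \<in> PiM A (\<lambda>_. borel) \<rightarrow>\<^sub>M S" and g [measurable]: "g \<in> PiM B (\<lambda>_. borel) \<rightarrow>\<^sub>M T"
  shows "distr M (S \<Otimes>\<^sub>M T) (\<lambda>\<omega>. (f (restrict (\<lambda>j. X j \<omega>) A), g (restrict (\<lambda>j. X j \<omega>) B)))
    = distr M S (\<lambda>\<omega>. f (restrict (\<lambda>j. X j \<omega>) A)) \<Otimes>\<^sub>M distr M T (\<lambda>\<omega>. g (restrict (\<lambda>j. X j \<omega>) B))"
proof -
  let ?P = "\<lambda>J. PiM J (\<lambda>_. borel :: real measure)"
  let ?W = "\<lambda>J \<omega>. restrict (\<lambda>j. X j \<omega>) J"
  interpret T: prob_space "distr (distr M (?P B) (?W B)) T g"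
    by (intro prob_space.prob_space_distr prob_space_distr) auto
  have "indep_var (?P A) (?W A) (?P B) (?W B)"
    using assms(1) by (intro indep_var_restrict[OF indep]) auto
  then have eq: "distr M (?P A \<Otimes>\<^sub>M ?P B) (\<lambda>\<omega>. (?W A \<omega>, ?W B \<omega>))
      = distr M (?P A) (?W A) \<Otimes>\<^sub>M distr M (?P B) (?W B)"
    by (simp add: indep_var_distribution_eq)
  have "distr M (S \<Otimes>\<^sub>M T) (\<lambda>\<omega>. (f (?W A \<omega>), g (?W B \<omega>)))
      = distr (distr M (?P A \<Otimes>\<^sub>M ?P B) (\<lambda>\<omega>. (?W A \<omega>, ?W B \<omega>))) (S \<Otimes>\<^sub>M T) (\<lambda>(v, w). (f v, g w))"
    by (subst distr_distr) (auto simp: comp_def)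
  also have "\<dots> = distr (distr M (?P A) (?W A)) S f \<Otimes>\<^sub>M distr (distr M (?P B) (?W B)) T g"
    unfolding eq by (intro pair_measure_distr[symmetric] T.sigma_finite_measure_axioms) auto
  also have "\<dots> = distr M S (\<lambda>\<omega>. f (?W A \<omega>)) \<Otimes>\<^sub>M distr M T (\<lambda>\<omega>. g (?W B \<omega>))"
    by (simp add: distr_distr comp_def)
  finally show ?thesis .
qed

lemma distr_pair:
  assumes "i \<noteq> j"
  shows "distr M (borel \<Otimes>\<^sub>M borel) (\<lambda>\<omega>. (X i \<omega>, X j \<omega>)) = U \<Otimes>\<^sub>M U"
  using distr_pair_restrict[of "{i}" "{j}" "\<lambda>v. v i" borel "\<lambda>v. v j" borel] assms
  by (simp add: distr_X)

lemma distr_triple: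
  assumes "i \<noteq> j" "i \<noteq> k" "j \<noteq> k"
  shows "distr M (borel \<Otimes>\<^sub>M borel \<Otimes>\<^sub>M borel) (\<lambda>\<omega>. (X i \<omega>, X j \<omega>, X k \<omega>)) = U \<Otimes>\<^sub>M U \<Otimes>\<^sub>M U"
  using distr_pair_restrict[of "{i}" "{j, k}" "\<lambda>v. v i" borel "\<lambda>v. (v j, v k)" "borel \<Otimes>\<^sub>M borel"] assms
  by (simp add: distr_X distr_pair)

text \<open>Fubini for one sample point. The other points enter as a tuple indexed by a set, so
  indices inside \<open>f\<close> may coincide as long as \<open>i\<close> is not among them; mixed
  products with a shared index need this.\<close>

lemma expectation_integrate_out:
  fixes f :: "real \<Rightarrow> (nat \<Rightarrow> real) \<Rightarrow> real"
  assumes f [measurable]: "(\<lambda>(x, v). f x v) \<in> borel_measurable (borel \<Otimes>\<^sub>M PiM J (\<lambda>_. borel))"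
    and "i \<notin> J" and bound: "\<And>x v. \<bar>f x v\<bar> \<le> C"
  shows "expectation (\<lambda>\<omega>. f (X i \<omega>) (restrict (\<lambda>j. X j \<omega>) J))
    = expectation (\<lambda>\<omega>. \<integral>x. f x (restrict (\<lambda>j. X j \<omega>) J) \<partial>U)"
proof -
  let ?P = "PiM J (\<lambda>_. borel :: real measure)"
  let ?W = "\<lambda>\<omega>. restrict (\<lambda>j. X j \<omega>) J"
  let ?D = "distr M ?P ?W"
  interpret D: prob_space ?D
    by (rule prob_space_distr) simp
  interpret P: pair_prob_space U ?D ..
  have eq: "distr M (borel \<Otimes>\<^sub>M ?P) (\<lambda>\<omega>. (X i \<omega>, ?W \<omega>)) = U \<Otimes>\<^sub>M ?D"
  proof -
    have "{i} \<inter> J = {}" using \<open>i \<notin> J\<close> by simp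
    from distr_pair_restrict[OF this measurable_component_singleton measurable_ident, of i]
    show ?thesis
      by (simp only: insertI1 True_implies_equals restrict_apply' distr_X id_apply simp_thms if_True)
  qed
  have "expectation (\<lambda>\<omega>. f (X i \<omega>) (?W \<omega>)) = (\<integral>p. (\<lambda>(x, v). f x v) p \<partial>(U \<Otimes>\<^sub>M ?D))"
    unfolding eq[symmetric] by (subst integral_distr) auto
  also have "\<dots> = (\<integral>v. (\<integral>x. f x v \<partial>U) \<partial>?D)"
  proof (rule P.integral_snd[symmetric])
    have "(\<lambda>(x, v). f x v) \<in> borel_measurable (U \<Otimes>\<^sub>M ?D)" by simp
    then show "integrable (U \<Otimes>\<^sub>M ?D) (\<lambda>(x, v). f x v)"
      by (intro P.integrable_const_bound[where B=C]) (auto simp: bound)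
  qed
  also have "\<dots> = expectation (\<lambda>\<omega>. \<integral>x. f x (?W \<omega>) \<partial>U)"
    by (subst integral_distr) auto
  finally show ?thesis .
qed

text \<open>A product of two terms has mean zero as soon as some index occurs in it only once:
  integrate that point first. What survives are pairs of index pairs on the same two indices, at
  most two for each of the \<open>n * (n - 1)\<close> ordered pairs.\<close>

lemma expectation_degenerate_sum_square:
  fixes \<psi> :: "real \<Rightarrow> real \<Rightarrow> real"
  assumes \<psi> [measurable]: "(\<lambda>(x, y). \<psi> x y) \<in> borel_measurable (borel \<Otimes>\<^sub>M borel)"
    and sym: "\<And>x y. \<psi> x y = \<psi> y x" and bound: "\<And>x y. \<bar>\<psi> x y\<bar> \<le> C"
    and degenerate: "\<And>y. (\<integral>x. \<psi> x y \<partial>U) = 0"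
  shows "expectation (\<lambda>\<omega>. (\<Sum>i<n. \<Sum>j\<in>{..<n}-{i}. \<psi> (X i \<omega>) (X j \<omega>))\<^sup>2)
    \<le> 2 * C\<^sup>2 * (real n * (real n - 1))"
proof -
  let ?P = "SIGMA i:{..<n}. {..<n} - {i}"
  let ?t = "\<lambda>p \<omega>. \<psi> (X (fst p) \<omega>) (X (snd p) \<omega>)"
  have C: "0 \<le> C"
    using bound[of 0 0] by simp
  have prod_bound: "\<bar>\<psi> x y * \<psi> z w\<bar> \<le> C * C" for x y z w
    unfolding abs_mult by (intro mult_mono bound C) simp
  have zero: "expectation (\<lambda>\<omega>. \<psi> (X i \<omega>) (X j \<omega>) * \<psi> (X k \<omega>) (X l \<omega>)) = 0"
    if "i \<noteq> j" "i \<noteq> k" "i \<noteq> l" for i j k l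
  proof -
    have "expectation (\<lambda>\<omega>. \<psi> (X i \<omega>) (restrict (\<lambda>j. X j \<omega>) {j, k, l} j)
        * \<psi> (restrict (\<lambda>j. X j \<omega>) {j, k, l} k) (restrict (\<lambda>j. X j \<omega>) {j, k, l} l)) = 0"
      using that
      by (subst expectation_integrate_out[where C="C * C"
            and f="\<lambda>x v. \<psi> x (v j) * \<psi> (v k) (v l)"])
         (auto simp: prod_bound degenerate)
    then show ?thesis by simp
  qed
  have int: "integrable M (\<lambda>\<omega>. ?t p \<omega> * ?t q \<omega>)" for p q
    by (intro integrable_const_bound[where B="C * C"]) (auto simp: prod_bound)
  have cross: "expectation (\<lambda>\<omega>. ?t p \<omega> * ?t q \<omega>) \<le> (if q \<in> {p, prod.swap p} then C\<^sup>2 else 0)"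
    if "p \<in> ?P" "q \<in> ?P" for p q
  proof -
    obtain i j k l where pq: "p = (i, j)" "q = (k, l)" by (cases p, cases q)
    with that have ne: "i \<noteq> j" "k \<noteq> l" by auto
    \<comment> \<open>If both indices of \<open>p\<close> occur in \<open>q\<close>, they exhaust
      \<open>q\<close>, being distinct, so \<open>q\<close> is \<open>p\<close> or its swap.
      Otherwise \<open>i\<close> or \<open>j\<close> is a lone index; in the last case symmetry of
      \<psi> moves \<open>j\<close> to the first argument.\<close>
    consider "q \<in> {p, prod.swap p}" | "i \<noteq> k" "i \<noteq> l" "q \<notin> {p, prod.swap p}"
      | "j \<noteq> k" "j \<noteq> l" "q \<notin> {p, prod.swap p}"
      using ne unfolding pq by auto
    then show ?thesis
    proof cases
      case 1
      have "expectation (\<lambda>\<omega>. ?t p \<omega> * ?t q \<omega>) \<le> expectation (\<lambda>\<omega>. C * C)"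
        by (intro integral_mono int) (auto intro!: abs_le_D1 prod_bound)
      with 1 show ?thesis by (simp add: power2_eq_square prob_space)
    next
      case 2
      then show ?thesis using zero[of i j k l] ne unfolding pq by simp
    next
      case 3
      then show ?thesis using zero[of j i k l] ne
        unfolding pq fst_conv snd_conv sym[of "X i _" "X j _"] by simp
    qed
  qed
  have "expectation (\<lambda>\<omega>. (\<Sum>i<n. \<Sum>j\<in>{..<n}-{i}. \<psi> (X i \<omega>) (X j \<omega>))\<^sup>2)
    = expectation (\<lambda>\<omega>. \<Sum>p\<in>?P. \<Sum>q\<in>?P. ?t p \<omega> * ?t q \<omega>)"
    by (simp add: sum.Sigma power2_eq_square sum_product case_prod_unfold)
  also have "\<dots> = (\<Sum>p\<in>?P. \<Sum>q\<in>?P. expectation (\<lambda>\<omega>. ?t p \<omega> * ?t q \<omega>))"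
    using int by (simp add: Bochner_Integration.integral_sum)
  also have "\<dots> \<le> (\<Sum>p\<in>?P. \<Sum>q\<in>?P. (if q \<in> {p, prod.swap p} then C\<^sup>2 else 0))"
    by (intro sum_mono cross)
  also have "\<dots> \<le> (\<Sum>p\<in>?P. 2 * C\<^sup>2)"
  proof (rule sum_mono)
    fix p
    have "(\<Sum>q\<in>?P. (if q \<in> {p, prod.swap p} then C\<^sup>2 else 0)) = (\<Sum>q\<in>?P \<inter> {p, prod.swap p}. C\<^sup>2)"
      by (subst sum.inter_restrict) auto
    also have "\<dots> = real (card (?P \<inter> {p, prod.swap p})) * C\<^sup>2"
      by simp
    also have "\<dots> \<le> 2 * C\<^sup>2"
    proof (rule mult_right_mono)
      have "card (?P \<inter> {p, prod.swap p}) \<le> card {p, prod.swap p}"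
        by (intro card_mono) auto
      also have "\<dots> \<le> 2" by (simp add: card_insert_if)
      finally show "real (card (?P \<inter> {p, prod.swap p})) \<le> 2" by simp
    qed simp
    finally show "(\<Sum>q\<in>?P. (if q \<in> {p, prod.swap p} then C\<^sup>2 else 0)) \<le> 2 * C\<^sup>2" .
  qed
  also have "\<dots> = real (card ?P) * (2 * C\<^sup>2)" by simp
  also have "card ?P = n * (n - 1)" by (simp add: card_SigmaI)
  finally show ?thesis by (cases n) (simp_all add: algebra_simps)
qed

end

text \<open>This is nonnegativity of the variance of \<open>\<bar>f \<omega>\<bar>\<close>.\<close>

lemma (in prob_space) expectation_abs_le_sqrt:
  fixes f :: "'a \<Rightarrow> real"
  assumes "integrable M f" "integrable M (\<lambda>\<omega>. (f \<omega>)\<^sup>2)"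
  shows "expectation (\<lambda>\<omega>. \<bar>f \<omega>\<bar>) \<le> sqrt (expectation (\<lambda>\<omega>. (f \<omega>)\<^sup>2))"
  using variance_eq[of "\<lambda>\<omega>. \<bar>f \<omega>\<bar>"] variance_positive[of "\<lambda>\<omega>. \<bar>f \<omega>\<bar>"] assms
  by (auto intro!: real_le_rsqrt)

section \<open>Hoeffding decomposition and the limit law\<close>

context iid_sample
begin

lemma U_statistic_clt:
  fixes h :: "real \<Rightarrow> real \<Rightarrow> real"
  assumes h [measurable]: "(\<lambda>(x, y). h x y) \<in> borel_measurable (borel \<Otimes>\<^sub>M borel)"
    and sym: "\<And>x y. h x y = h y x" and bound: "\<And>x y. \<bar>h x y\<bar> \<le> C"
  defines "h1 \<equiv> \<lambda>x. \<integral>y. h x y \<partial>U"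
  defines "\<theta> \<equiv> \<integral>x. h1 x \<partial>U"
  defines "\<zeta> \<equiv> \<integral>x. (h1 x - \<theta>)\<^sup>2 \<partial>U"
  assumes "0 < \<zeta>"
  shows "weak_conv_m
    (\<lambda>n. distr M borel (\<lambda>\<omega>. sqrt (real n) *
      ((\<Sum>i<n. \<Sum>j\<in>{..<n}-{i}. h (X i \<omega>) (X j \<omega>)) / (real n * (real n - 1)) - \<theta>)))
    (density lborel (normal_density 0 (sqrt (4 * \<zeta>))))"
proof -
  define \<sigma> where "\<sigma> = sqrt \<zeta>"
  have \<sigma>: "0 < \<sigma>" "\<sigma>\<^sup>2 = \<zeta>" and s: "sqrt (4 * \<zeta>) = 2 * \<sigma>"
    using \<open>0 < \<zeta>\<close> by (auto simp: \<sigma>_def real_sqrt_mult)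
  have C: "0 \<le> C"
    using bound[of 0 0] by simp
  have h1_bound: "\<bar>h1 x\<bar> \<le> C" for x
    unfolding h1_def using U.integrable_const_bound[of "h x" C] bound
    by (intro order_trans[OF integral_abs_bound] U.integral_le_const) auto
  have [measurable]: "h1 \<in> borel_measurable borel"
    unfolding h1_def by measurable
  have int_h1: "integrable U h1"
    by (intro U.integrable_const_bound[where B=C]) (auto simp: h1_bound)
  have \<theta>_bound: "\<bar>\<theta>\<bar> \<le> C"
    unfolding \<theta>_def using h1_bound int_h1
    by (intro order_trans[OF integral_abs_bound] U.integral_le_const) auto
  define Z where "Z i \<omega> = h1 (X i \<omega>) - \<theta>" for i \<omega>
  have [measurable]: "Z i \<in> borel_measurable M" for i
    unfolding Z_def by measurable
  have Z_bound: "\<bar>Z i \<omega>\<bar> \<le> 2 * C" for i \<omega>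
    using h1_bound[of "X i \<omega>"] \<theta>_bound unfolding Z_def by linarith
  have E_U: "expectation (\<lambda>\<omega>. f (X i \<omega>)) = (\<integral>x. f x \<partial>U)"
    if "f \<in> borel_measurable borel" for f :: "real \<Rightarrow> real" and i
    unfolding distr_X[of i, symmetric] using that by (subst integral_distr) auto
  have Z_mean: "expectation (Z i) = 0" for i
    using E_U[of "\<lambda>x. h1 x - \<theta>" i] int_h1
    by (simp add: Z_def[abs_def] \<theta>_def[symmetric] U.prob_space[unfolded space_U])
  have Z_clt: "weak_conv_m (\<lambda>n. distr M borel (\<lambda>\<omega>. (\<Sum>i<n. Z i \<omega>) / sqrt (n * \<sigma>\<^sup>2)))
      std_normal_distribution"
  proof (rule central_limit_theorem_zero_mean)
    show "indep_vars (\<lambda>i. borel) Z UNIV"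
      unfolding Z_def by (intro indep_vars_compose2[OF indep]) simp
    show "integrable M (\<lambda>\<omega>. (Z i \<omega>)\<^sup>2)" for i
      using power_mono[OF Z_bound abs_ge_zero, of i _ 2]
      by (intro integrable_const_bound[where B="(2 * C)\<^sup>2"]) (auto simp del: power_mult_distrib)
    show "variance (Z i) = \<sigma>\<^sup>2" for i
      unfolding Z_mean \<sigma> \<zeta>_def using E_U[of "\<lambda>x. (h1 x - \<theta>)\<^sup>2" i] by (simp add: Z_def)
    show "distr M borel (Z i) = distr U borel (\<lambda>x. h1 x - \<theta>)" for i
      unfolding distr_X[of i, symmetric] Z_def by (subst distr_distr) (auto simp: comp_def)
  qed (use Z_mean \<sigma> in auto)
  \<comment> \<open>The projection part, 2 / sqrt n times the sum of the \<open>Z i\<close>, written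
    as a multiple of the normalised sum so that \<open>Z_clt\<close> applies after
    rescaling.\<close>
  define A where "A n \<omega> = (2 * \<sigma>) * ((\<Sum>i<n. Z i \<omega>) / sqrt (n * \<sigma>\<^sup>2))" for n \<omega>
  have [measurable]: "A n \<in> borel_measurable M" for n
    unfolding A_def by measurable
  have A_clt: "weak_conv_m (\<lambda>n. distr M borel (A n)) (density lborel (normal_density 0 (2 * \<sigma>)))"
    using weak_conv_m_distr_mult[OF _ real_dist_normal_dist Z_clt, of "2 * \<sigma>"] \<sigma>
    by (simp add: distr_std_normal_mult distr_distr comp_def A_def[abs_def])

  \<comment> \<open>Subtracting both projections removes the mean once too often, whence the
    \<open>+ \<theta>\<close>. The bound \<open>4 * C\<close> counts the four terms.\<close>
  define \<psi> where "\<psi> x y = h x y - h1 x - h1 y + \<theta>" for x y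
  have \<psi>_meas [measurable]: "(\<lambda>(x, y). \<psi> x y) \<in> borel_measurable (borel \<Otimes>\<^sub>M borel)"
    unfolding \<psi>_def by measurable
  have \<psi>_sym: "\<psi> x y = \<psi> y x" for x y
    by (simp add: \<psi>_def sym[of x y])
  have \<psi>_bound: "\<bar>\<psi> x y\<bar> \<le> 4 * C" for x y
    using bound[of x y] h1_bound[of x] h1_bound[of y] \<theta>_bound unfolding \<psi>_def by linarith
  have degenerate: "(\<integral>x. \<psi> x y \<partial>U) = 0" for y
  proof -
    have "integrable U (\<lambda>x. h x y)"
      using bound by (intro U.integrable_const_bound[where B=C]) auto
    moreover have "(\<integral>x. h x y \<partial>U) = h1 y"
      unfolding h1_def by (rule Bochner_Integration.integral_cong[OF refl sym])
    ultimately show ?thesis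
      using int_h1 by (simp add: \<psi>_def \<theta>_def[symmetric] U.prob_space[unfolded space_U])
  qed
  let ?S = "\<lambda>n \<omega>. \<Sum>i<n. \<Sum>j\<in>{..<n}-{i}. \<psi> (X i \<omega>) (X j \<omega>)"
  let ?V = "\<lambda>n \<omega>. sqrt (real n) *
      ((\<Sum>i<n. \<Sum>j\<in>{..<n}-{i}. h (X i \<omega>) (X j \<omega>)) / (real n * (real n - 1)) - \<theta>)"
  define B where "B n \<omega> = ?V n \<omega> - A n \<omega>" for n \<omega>
  \<comment> \<open>Hoeffding decomposition: \<open>B\<close> is the degenerate part, of order \<open>n powr (- 1 / 2)\<close> in L1.\<close>
  have hoeffding: "B n \<omega> = sqrt n / (n * (real n - 1)) * ?S n \<omega>" if "2 \<le> n" for n \<omega>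
  proof -
    \<comment> \<open>Every index stands in first position of \<open>n - 1\<close> ordered pairs,
      and in second position of as many; hence two copies of the sum of the
      \<open>Z i\<close>.\<close>
    have const: "(\<Sum>i<n. \<Sum>j\<in>{..<n}-{i}. a i) = (real n - 1) * (\<Sum>i<n. a i)" for a :: "nat \<Rightarrow> real"
      using that by (simp add: sum_distrib_left of_nat_diff)
    have const': "(\<Sum>i<n. \<Sum>j\<in>{..<n}-{i}. a j) = (real n - 1) * (\<Sum>i<n. a i)" for a :: "nat \<Rightarrow> real"
      by (simp add: sum_diff1 sum_subtractf algebra_simps)
    have "h (X i \<omega>) (X j \<omega>) = \<psi> (X i \<omega>) (X j \<omega>) + (Z i \<omega> + Z j \<omega> + \<theta>)" for i j
      by (simp add: \<psi>_def Z_def)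
    then have "(\<Sum>i<n. \<Sum>j\<in>{..<n}-{i}. h (X i \<omega>) (X j \<omega>))
        = ?S n \<omega> + ((real n - 1) * (\<Sum>i<n. Z i \<omega>) + (real n - 1) * (\<Sum>i<n. Z i \<omega>)
          + (real n - 1) * (\<Sum>i<n. \<theta>))"
      by (simp only: sum.distrib const const')
    then have "(\<Sum>i<n. \<Sum>j\<in>{..<n}-{i}. h (X i \<omega>) (X j \<omega>))
        = ?S n \<omega> + 2 * ((real n - 1) * (\<Sum>i<n. Z i \<omega>)) + n * (real n - 1) * \<theta>"
      by (simp add: algebra_simps)
    then have "(\<Sum>i<n. \<Sum>j\<in>{..<n}-{i}. h (X i \<omega>) (X j \<omega>)) / (real n * (real n - 1)) - \<theta>
        = ?S n \<omega> / (real n * (real n - 1)) + 2 * (\<Sum>i<n. Z i \<omega>) / n"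
      using that by (simp add: add_divide_distrib)
    moreover have "A n \<omega> = sqrt n * (2 * (\<Sum>i<n. Z i \<omega>) / n)"
      using that \<sigma>(1) by (simp add: A_def real_sqrt_mult field_simps)
    ultimately show ?thesis
      unfolding B_def by (simp add: distrib_left)
  qed
  have "integrable M (\<lambda>\<omega>. h (X i \<omega>) (X j \<omega>))" for i j
    using bound by (intro integrable_const_bound[where B=C]) auto
  moreover have "integrable M (Z i)" for i
    using Z_bound by (intro integrable_const_bound[where B="2 * C"]) auto
  ultimately have int_B: "integrable M (B n)" for n
    unfolding B_def A_def by auto
  have [measurable]: "B n \<in> borel_measurable M" for n
    using int_B by auto
  \<comment> \<open>The squared prefactor is 1 / (n * (n - 1)^2) and the second-moment bound, with
    \<open>4 * C\<close> bounding \<psi>, contributes n * (n - 1); their product leaves 1 / (n -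
    1).\<close>
  have L1_bound: "expectation (\<lambda>\<omega>. \<bar>B n \<omega>\<bar>) \<le> sqrt (2 * (4 * C)\<^sup>2 * inverse (real n - 1))"
    if n: "2 \<le> n" for n
  proof -
    let ?c = "sqrt n / (n * (real n - 1))"
    have "\<bar>?S n \<omega>\<bar> \<le> (\<Sum>i<n. \<Sum>j\<in>{..<n}-{i}. 4 * C)" for \<omega>
      by (intro order_trans[OF sum_abs] sum_mono \<psi>_bound)
    then have "(?S n \<omega>)\<^sup>2 \<le> (\<Sum>i<n. \<Sum>j\<in>{..<n}-{i}. 4 * C)\<^sup>2" for \<omega>
      using power_mono[OF _ abs_ge_zero, of "?S n \<omega>" _ 2] by simp
    then have int_S: "integrable M (\<lambda>\<omega>. (?S n \<omega>)\<^sup>2)"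
      by (intro integrable_const_bound[where B="(\<Sum>i<n. \<Sum>j\<in>{..<n}-{i}. 4 * C)\<^sup>2"]) auto
    have sq: "(B n \<omega>)\<^sup>2 = ?c\<^sup>2 * (?S n \<omega>)\<^sup>2" for \<omega>
      unfolding hoeffding[OF n] by (rule power_mult_distrib)
    have "expectation (\<lambda>\<omega>. \<bar>B n \<omega>\<bar>) \<le> sqrt (expectation (\<lambda>\<omega>. (B n \<omega>)\<^sup>2))"
      by (intro expectation_abs_le_sqrt int_B) (use int_S in \<open>simp add: sq\<close>)
    also have "expectation (\<lambda>\<omega>. (B n \<omega>)\<^sup>2) \<le> ?c\<^sup>2 * (2 * (4 * C)\<^sup>2 * (real n * (real n - 1)))"
      unfolding sq integral_mult_right_zero
      by (intro mult_left_mono expectation_degenerate_sum_square \<psi>_meas \<psi>_sym \<psi>_bound degenerate) simp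
    also have "\<dots> = 2 * (4 * C)\<^sup>2 * inverse (real n - 1)"
    proof -
      have "(sqrt a / (a * b))\<^sup>2 * (K * (a * b)) = K * inverse b" if "0 < a" "0 < b" for a b K :: real
        using that by (simp add: power_divide power2_eq_square field_simps)
      then show ?thesis using n by simp
    qed
    finally show ?thesis by simp
  qed
  have B_lim: "(\<lambda>n. expectation (\<lambda>\<omega>. \<bar>B n \<omega>\<bar>)) \<longlonglongrightarrow> 0"
  proof (rule tendsto_sandwich[OF _ _ tendsto_const])
    have "filterlim (\<lambda>n. real n - 1) at_top sequentially"
      using filterlim_tendsto_add_at_top[OF tendsto_const[of "- 1"] filterlim_real_sequentially]
      by simp
    then have "(\<lambda>n. sqrt (2 * (4 * C)\<^sup>2 * inverse (real n - 1))) \<longlonglongrightarrow> sqrt (2 * (4 * C)\<^sup>2 * 0)"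
      by (intro tendsto_intros tendsto_inverse_0_at_top)
    then show "(\<lambda>n. sqrt (2 * (4 * C)\<^sup>2 * inverse (real n - 1))) \<longlonglongrightarrow> 0"
      by simp
    show "\<forall>\<^sub>F n in sequentially.
        expectation (\<lambda>\<omega>. \<bar>B n \<omega>\<bar>) \<le> sqrt (2 * (4 * C)\<^sup>2 * inverse (real n - 1))"
      using L1_bound by (intro eventually_sequentiallyI)
  qed auto
  have "weak_conv_m (\<lambda>n. distr M borel (\<lambda>\<omega>. A n \<omega> + B n \<omega>)) (density lborel (normal_density 0 (2 * \<sigma>)))"
  proof (rule weak_conv_m_add_vanishing[OF _ int_B A_clt _ B_lim])
    interpret N: prob_space "density lborel (normal_density 0 (2 * \<sigma>))"
      using \<sigma> by (intro prob_space_normal_density) simp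
    show "real_distribution (density lborel (normal_density 0 (2 * \<sigma>)))"
      by unfold_locales auto
  qed simp
  then show ?thesis
    by (simp add: B_def s)
qed

end

section \<open>Relative density of a proximity digraph\<close>

lemma parcs_proximity_digraph_image:
  assumes "inj_on x K"
  shows "parcs (proximity_digraph N (x ` K))
    = map_prod x x ` {(i, j) \<in> K \<times> K. i \<noteq> j \<and> x j \<in> N (x i)}"
  using assms unfolding proximity_digraph_def by (auto simp: image_iff inj_on_eq_iff)

text \<open>Injectivity lets vertices and arcs be counted by indices; this is where coinciding
  points must be excluded.\<close>

lemma relative_density_image:
  assumes "inj_on x K" "finite K"
  shows "relative_density (proximity_digraph N (x ` K))
    = (\<Sum>i\<in>K. \<Sum>j\<in>K-{i}. indicator (N (x i)) (x j)) / (real (card K) * (real (card K) - 1))"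
proof -
  let ?A = "{(i, j) \<in> K \<times> K. i \<noteq> j \<and> x j \<in> N (x i)}"
  have "card (parcs (proximity_digraph N (x ` K))) = card ?A"
    unfolding parcs_proximity_digraph_image[OF assms(1)]
    by (intro card_image inj_on_subset[OF map_prod_inj_on[OF assms(1) assms(1)]]) auto
  moreover have "?A = (SIGMA i:K. {j \<in> K - {i}. x j \<in> N (x i)})" by auto
  moreover have "card (SIGMA i:K. {j \<in> K - {i}. x j \<in> N (x i)})
      = (\<Sum>i\<in>K. card {j \<in> K - {i}. x j \<in> N (x i)})"
    using assms(2) by (intro card_SigmaI) auto
  moreover have "(\<Sum>j\<in>K-{i}. indicator (N (x i)) (x j)) = real (card {j \<in> K - {i}. x j \<in> N (x i)})" for i
    using assms(2) by (simp add: indicator_def sum.If_cases Int_def)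
  moreover have "card (pverts (proximity_digraph N (x ` K))) = card K"
    using assms by (simp add: proximity_digraph_def card_image)
  ultimately show ?thesis
    unfolding relative_density_def by simp
qed

text \<open>The density depends only on the isomorphism class of the digraph, and an injection that
  matches regions in both directions is an isomorphism onto its image.\<close>

lemma relative_density_equivariant:
  assumes "inj f" and "\<And>x y. f y \<in> N' (f x) \<longleftrightarrow> y \<in> N x"
  shows "relative_density (proximity_digraph N' (f ` V)) = relative_density (proximity_digraph N V)"
proof -
  have inj: "inj_on f V"
    using assms(1) by (rule inj_on_subset) simp
  have "parcs (proximity_digraph N' (f ` V)) = map_prod f f ` parcs (proximity_digraph N V)"
    unfolding parcs_proximity_digraph_image[OF inj] assms(2) by (auto simp: proximity_digraph_def)
  then have "card (parcs (proximity_digraph N' (f ` V))) = card (parcs (proximity_digraph N V))"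
    using prod.inj_map[OF assms(1) assms(1)] by (metis card_image inj_on_subset subset_UNIV)
  moreover have "card (pverts (proximity_digraph N' (f ` V))) = card (pverts (proximity_digraph N V))"
    by (simp add: proximity_digraph_def card_image[OF inj])
  ultimately show ?thesis unfolding relative_density_def by simp
qed

lemma sym_arc_commute: "sym_arc N x y = sym_arc N y x"
  by (simp add: sym_arc_def add.commute)

lemma sym_arc_bound: "\<bar>sym_arc N x y\<bar> \<le> 1"
  by (simp add: sym_arc_def indicator_def)

text \<open>Over all ordered pairs, exchanging \<open>i\<close> and \<open>j\<close> turns the
  reversed indicator into the direct one, so symmetrising the kernel preserves the total.\<close>

lemma sum_sym_arc:
  fixes n :: nat
  shows "(\<Sum>i<n. \<Sum>j\<in>{..<n}-{i}. sym_arc N (x i) (x j))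
    = (\<Sum>i<n. \<Sum>j\<in>{..<n}-{i}. indicator (N (x i)) (x j))"
proof -
  have swap: "(\<Sum>i<n. \<Sum>j\<in>{..<n}-{i}. g j i) = (\<Sum>i<n. \<Sum>j\<in>{..<n}-{i}. g i j)"
    for g :: "nat \<Rightarrow> nat \<Rightarrow> real"
  proof -
    have "(\<Sum>i<n. \<Sum>j\<in>{..<n}-{i}. g j i) = (\<Sum>i<n. \<Sum>j | j \<in> {..<n} \<and> i \<noteq> j. g j i)"
      by (intro sum.cong refl) auto
    also have "\<dots> = (\<Sum>j<n. \<Sum>i | i \<in> {..<n} \<and> i \<noteq> j. g j i)"
      by (rule sum.swap_restrict) auto
    also have "\<dots> = (\<Sum>j<n. \<Sum>i\<in>{..<n}-{j}. g j i)"
      by (intro sum.cong refl) auto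
    finally show ?thesis .
  qed
  show ?thesis
    using swap[of "\<lambda>i j. indicator (N (x i)) (x j)"]
    by (simp add: sym_arc_def sum.distrib sum_divide_distrib[symmetric])
qed

section \<open>The first projection of the arc kernel and its variance\<close>

locale proximity_kernel = U: prob_space U for U :: "real measure" +
  fixes N :: "real \<Rightarrow> real set"
  assumes sets_U [simp, measurable_cong]: "sets U = sets borel"
    and arcs_measurable: "{p. snd p \<in> N (fst p)} \<in> sets (borel \<Otimes>\<^sub>M borel)"
begin

sublocale P: pair_prob_space U U ..

lemma space_U [simp]: "space U = UNIV"
  using sets_eq_imp_space_eq[OF sets_U] by simp

lemma arc_measurable [measurable]:
  "(\<lambda>(x, y). indicator (N x) y :: real) \<in> borel_measurable (borel \<Otimes>\<^sub>M borel)"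
proof -
  have "(\<lambda>(x, y). indicator (N x) y :: real) = indicator {p. snd p \<in> N (fst p)}"
    by (auto simp: fun_eq_iff indicator_def)
  then show ?thesis using arcs_measurable by simp
qed

lemma sym_arc_measurable [measurable]:
  "(\<lambda>(x, y). sym_arc N x y) \<in> borel_measurable (borel \<Otimes>\<^sub>M borel)"
  unfolding sym_arc_def by measurable

text \<open>The first Hoeffding projection of the kernel: the average of the probabilities of an arc
  out of \<open>x\<close> and of an arc into \<open>x\<close>.\<close>

definition degree :: "real \<Rightarrow> real" where
  "degree x = (\<integral>y. sym_arc N x y \<partial>U)"

lemma degree_measurable [measurable]: "degree \<in> borel_measurable borel"
  unfolding degree_def by measurable

lemma degree_eq:
  assumes "{y. y \<in> N x} \<in> sets borel" "{y. x \<in> N y} \<in> sets borel"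
  shows "degree x = (measure U {y. y \<in> N x} + measure U {y. x \<in> N y}) / 2"
proof -
  have "sym_arc N x = (\<lambda>y. (indicator {y. y \<in> N x} y + indicator {y. x \<in> N y} y) / 2)"
    by (auto simp: sym_arc_def fun_eq_iff indicator_def)
  moreover have "integrable U (indicator {y. y \<in> N x} :: real \<Rightarrow> real)"
      "integrable U (indicator {y. x \<in> N y} :: real \<Rightarrow> real)"
    using assms by (auto intro!: U.integrable_const_bound[where B=1])
  ultimately show ?thesis
    using assms by (simp add: degree_def)
qed

lemma arc_prob_eq_integral: "arc_prob U N = (\<integral>p. (\<lambda>(x, y). indicator (N x) y) p \<partial>(U \<Otimes>\<^sub>M U))"
proof -
  have "{(x1, x2) \<in> space (U \<Otimes>\<^sub>M U). x2 \<in> N x1} = {p. snd p \<in> N (fst p)}"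
    by (auto simp: space_pair_measure)
  moreover have "(\<lambda>(x, y). indicator (N x) y :: real) = indicator {p. snd p \<in> N (fst p)}"
    by (auto simp: fun_eq_iff indicator_def)
  ultimately show ?thesis
    using arcs_measurable by (simp add: arc_prob_def)
qed

lemma integral_degree: "(\<integral>x. degree x \<partial>U) = arc_prob U N"
proof -
  have int: "integrable (U \<Otimes>\<^sub>M U) (\<lambda>(x, y). indicator (N x) y :: real)"
    by (intro P.integrable_const_bound[where B=1]) (auto split: split_indicator)
  have int': "integrable (U \<Otimes>\<^sub>M U) (\<lambda>(x, y). indicator (N y) x :: real)"
    using P.integrable_product_swap[OF int] by (simp add: case_prod_unfold)
  have "(\<integral>x. degree x \<partial>U) = (\<integral>p. (\<lambda>(x, y). sym_arc N x y) p \<partial>(U \<Otimes>\<^sub>M U))"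
    unfolding degree_def
    by (intro P.integral_fst P.integrable_const_bound[where B=1]) (auto simp: sym_arc_bound)
  also have "\<dots> = ((\<integral>p. (\<lambda>(x, y). indicator (N x) y) p \<partial>(U \<Otimes>\<^sub>M U))
      + (\<integral>p. (\<lambda>(x, y). indicator (N y) x) p \<partial>(U \<Otimes>\<^sub>M U))) / 2"
    using int int' by (simp add: sym_arc_def case_prod_unfold)
  also have "(\<integral>p. (\<lambda>(x, y). indicator (N y) x :: real) p \<partial>(U \<Otimes>\<^sub>M U))
      = (\<integral>p. (\<lambda>(x, y). indicator (N x) y) p \<partial>(U \<Otimes>\<^sub>M U))"
    using P.integral_product_swap[of "\<lambda>(x, y). indicator (N x) y :: real"]
    by (simp add: case_prod_unfold)
  finally show ?thesis
    by (simp add: arc_prob_eq_integral)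
qed

text \<open>Given the common point \<open>x1\<close>, the kernels towards \<open>x2\<close> and
  \<open>x3\<close> are independent, so the product of the centred kernels integrates to the square
  of the centred projection.\<close>

lemma arc_cov_eq: "arc_cov U N = (\<integral>x. (degree x - arc_prob U N)\<^sup>2 \<partial>U)"
proof -
  interpret T: pair_prob_space U "U \<Otimes>\<^sub>M U" ..
  let ?\<theta> = "arc_prob U N"
  have int: "integrable U (sym_arc N x)" for x
    by (intro U.integrable_const_bound[where B=1]) (auto simp: sym_arc_bound)
  have b: "\<bar>sym_arc N x y\<bar> \<le> 2" for x y
    using sym_arc_bound[of N x y] by linarith
  have \<theta>: "\<bar>?\<theta>\<bar> \<le> 1"
    unfolding arc_prob_def by simp
  have 2: "(\<integral>p. f (fst p) * g (snd p) \<partial>(U \<Otimes>\<^sub>M U)) = (\<integral>y. f y \<partial>U) * (\<integral>z. g z \<partial>U)"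
    if [measurable]: "f \<in> borel_measurable borel" "g \<in> borel_measurable borel"
      and "\<And>y. \<bar>f y\<bar> \<le> 2" "\<And>y. \<bar>g y\<bar> \<le> 2" for f g :: "real \<Rightarrow> real"
  proof -
    have "\<bar>f y * g z\<bar> \<le> 2 * 2" for y z
      unfolding abs_mult using that by (intro mult_mono) auto
    then have "integrable (U \<Otimes>\<^sub>M U) (\<lambda>(y, z). f y * g z)"
      by (intro P.integrable_const_bound[where B="2 * 2"]) auto
    from P.integral_fst[OF this] show ?thesis
      by (simp add: case_prod_unfold)
  qed
  \<comment> \<open>The bound 2 fits every use: the kernel, the constant 1 that produces the means
    \<open>m2\<close> and \<open>m3\<close>, and the kernel minus its mean.\<close>
  have 3: "(\<integral>p. f (fst p) (fst (snd p)) * g (fst p) (snd (snd p)) \<partial>(U \<Otimes>\<^sub>M U \<Otimes>\<^sub>M U))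
      = (\<integral>x. (\<integral>y. f x y \<partial>U) * (\<integral>z. g x z \<partial>U) \<partial>U)"
    if [measurable]: "(\<lambda>(x, y). f x y) \<in> borel_measurable (borel \<Otimes>\<^sub>M borel)"
        "(\<lambda>(x, y). g x y) \<in> borel_measurable (borel \<Otimes>\<^sub>M borel)"
      and fg: "\<And>x y. \<bar>f x y\<bar> \<le> 2" "\<And>x y. \<bar>g x y\<bar> \<le> 2" for f g :: "real \<Rightarrow> real \<Rightarrow> real"
  proof -
    have "\<bar>f x y * g x z\<bar> \<le> 2 * 2" for x y z
      unfolding abs_mult using fg by (intro mult_mono) auto
    then have "integrable (U \<Otimes>\<^sub>M U \<Otimes>\<^sub>M U) (\<lambda>(x, q). f x (fst q) * g x (snd q))"
      by (intro T.integrable_const_bound[where B="2 * 2"]) auto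
    from T.integral_fst[OF this] show ?thesis
      by (simp add: case_prod_unfold 2 fg)
  qed
  have m2: "(\<integral>p. sym_arc N (fst p) (fst (snd p)) \<partial>(U \<Otimes>\<^sub>M U \<Otimes>\<^sub>M U)) = ?\<theta>"
    using 3[of "sym_arc N" "\<lambda>_ _. 1", OF sym_arc_measurable _ b]
    by (simp add: degree_def[symmetric] integral_degree U.prob_space[simplified])
  have m3: "(\<integral>p. sym_arc N (fst p) (snd (snd p)) \<partial>(U \<Otimes>\<^sub>M U \<Otimes>\<^sub>M U)) = ?\<theta>"
    using 3[of "\<lambda>_ _. 1" "sym_arc N", OF _ sym_arc_measurable _ b]
    by (simp add: degree_def[symmetric] integral_degree U.prob_space[simplified])
  have "\<bar>sym_arc N x y - ?\<theta>\<bar> \<le> 2" for x y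
    using sym_arc_bound[of N x y] \<theta> by linarith
  then have "arc_cov U N = (\<integral>x. (\<integral>y. sym_arc N x y - ?\<theta> \<partial>U) * (\<integral>z. sym_arc N x z - ?\<theta> \<partial>U) \<partial>U)"
    using 3[of "\<lambda>x y. sym_arc N x y - ?\<theta>" "\<lambda>x y. sym_arc N x y - ?\<theta>"]
    by (simp add: arc_cov_def covariance_def case_prod_unfold m2 m3)
  then show ?thesis
    using int by (simp add: degree_def power2_eq_square U.prob_space[simplified])
qed

text \<open>Variance zero would force the projection to equal its mean almost everywhere.\<close>

lemma arc_cov_pos:
  assumes "\<And>k. \<not> (AE x in U. degree x = k)"
  shows "0 < arc_cov U N"
proof -
  have bound: "\<bar>degree x\<bar> \<le> 1" for x
    unfolding degree_def using U.integrable_const_bound[of "sym_arc N x" 1]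
    by (intro order_trans[OF integral_abs_bound] U.integral_le_const) (auto simp: sym_arc_bound)
  have "\<bar>arc_prob U N\<bar> \<le> 1" unfolding arc_prob_def by simp
  then have "\<bar>degree x - arc_prob U N\<bar> \<le> 2" for x
    using bound[of x] by linarith
  then have "(degree x - arc_prob U N)\<^sup>2 \<le> 2\<^sup>2" for x
    using power_mono[OF _ abs_ge_zero, of "degree x - arc_prob U N" 2 2] by simp
  then have "integrable U (\<lambda>x. (degree x - arc_prob U N)\<^sup>2)"
    by (intro U.integrable_const_bound[where B="2\<^sup>2"]) auto
  from integral_nonneg_eq_0_iff_AE[OF this] assms[of "arc_prob U N"]
  have "(\<integral>x. (degree x - arc_prob U N)\<^sup>2 \<partial>U) \<noteq> 0" by simp
  moreover have "0 \<le> (\<integral>x. (degree x - arc_prob U N)\<^sup>2 \<partial>U)" by simp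
  ultimately show ?thesis unfolding arc_cov_eq by linarith
qed

end

section \<open>Arc probabilities, moments and limit law of the density of a random sample\<close>

context iid_sample
begin

context
  fixes N :: "real \<Rightarrow> real set"
  assumes kernel: "proximity_kernel U N"
begin

interpretation K: proximity_kernel U N by (fact kernel)

lemma indicator_arc_measurable [measurable]:
  "(\<lambda>\<omega>. indicator (N (X i \<omega>)) (X j \<omega>) :: real) \<in> borel_measurable M"
  using measurable_compose[OF _ K.arc_measurable, of "\<lambda>\<omega>. (X i \<omega>, X j \<omega>)"] by simp

lemma arc_probability:
  assumes "i \<noteq> j"
  shows "measure M {\<omega> \<in> space M. X j \<omega> \<in> N (X i \<omega>)} = arc_prob U N"
proof -
  have "arc_prob U N = measure (U \<Otimes>\<^sub>M U) {p. snd p \<in> N (fst p)}"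
    unfolding arc_prob_def by (rule arg_cong[where f="measure _"]) (auto simp: space_pair_measure)
  also have "\<dots> = measure M ((\<lambda>\<omega>. (X i \<omega>, X j \<omega>)) -` {p. snd p \<in> N (fst p)} \<inter> space M)"
    unfolding distr_pair[OF assms, symmetric] by (rule measure_distr) (auto simp: K.arcs_measurable)
  also have "(\<lambda>\<omega>. (X i \<omega>, X j \<omega>)) -` {p. snd p \<in> N (fst p)} \<inter> space M
      = {\<omega> \<in> space M. X j \<omega> \<in> N (X i \<omega>)}" by auto
  finally show ?thesis by simp
qed

lemma expectation_indicator_arc:
  assumes "i \<noteq> j"
  shows "expectation (\<lambda>\<omega>. indicator (N (X i \<omega>)) (X j \<omega>)) = arc_prob U N"
  unfolding K.arc_prob_eq_integral distr_pair[OF assms, symmetric]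
  by (subst integral_distr) auto

lemma covariance_sym_arc:
  assumes "i \<noteq> j" "i \<noteq> k" "j \<noteq> k"
  shows "covariance M (\<lambda>\<omega>. sym_arc N (X i \<omega>) (X j \<omega>)) (\<lambda>\<omega>. sym_arc N (X i \<omega>) (X k \<omega>)) = arc_cov U N"
  unfolding arc_cov_def covariance_def distr_triple[OF assms, symmetric]
  by (subst (1 2 3) integral_distr) (auto simp: case_prod_unfold)

lemma relative_density_measurable:
  "(\<lambda>\<omega>. relative_density (proximity_digraph N ((\<lambda>j. X j \<omega>) ` {..<n}))) \<in> borel_measurable M"
proof -
  \<comment> \<open>Points may coincide on a null set; keeping the first occurrence of each value makes
    the image injective for every \<open>\<omega>\<close>, so that the density is measurable outright.\<close>
  define K where "K \<omega> = {j\<in>{..<n}. \<forall>i<j. X i \<omega> \<noteq> X j \<omega>}" for \<omega>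
  have fin: "finite (K \<omega>)" and sub: "K \<omega> \<subseteq> {..<n}" for \<omega>
    by (auto simp: K_def)
  have inj: "inj_on (\<lambda>j. X j \<omega>) (K \<omega>)" for \<omega>
    by (rule inj_onI) (metis (mono_tags, lifting) K_def linorder_neqE_nat mem_Collect_eq)
  have im: "(\<lambda>j. X j \<omega>) ` {..<n} = (\<lambda>j. X j \<omega>) ` K \<omega>" for \<omega>
  proof
    show "(\<lambda>j. X j \<omega>) ` {..<n} \<subseteq> (\<lambda>j. X j \<omega>) ` K \<omega>"
    proof clarify
      fix j assume "j < n"
      obtain l where l: "X l \<omega> = X j \<omega>" "\<And>i. X i \<omega> = X j \<omega> \<Longrightarrow> l \<le> i"
        using LeastI[of "\<lambda>l. X l \<omega> = X j \<omega>" j] Least_le[of "\<lambda>l. X l \<omega> = X j \<omega>"] by blast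
      have "l < n" using l(2)[OF refl] \<open>j < n\<close> by (rule le_less_trans)
      moreover have "X i \<omega> \<noteq> X l \<omega>" if "i < l" for i
        using l(2)[of i] that unfolding l(1) by (auto simp: not_le)
      ultimately have "l \<in> K \<omega>"
        unfolding K_def by simp
      with l(1)[symmetric] show "X j \<omega> \<in> (\<lambda>j. X j \<omega>) ` K \<omega>" by (intro image_eqI)
    qed
  qed (use sub in auto)
  have [measurable]: "(\<lambda>\<omega>. j \<in> K \<omega>) \<in> measurable M (count_space UNIV)" for j
    unfolding K_def by measurable
  have K_sum: "(\<Sum>j\<in>K \<omega>. f j) = (\<Sum>j<n. if j \<in> K \<omega> then f j else 0)" for f :: "nat \<Rightarrow> real" and \<omega>
    using sum.inter_restrict[of "{..<n}" f "K \<omega>"] sub[of \<omega>] by (simp add: Int_absorb1)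
  have K_diff_sum: "(\<Sum>j\<in>K \<omega> - {i}. f j) = (\<Sum>j<n. if j \<in> K \<omega> \<and> j \<noteq> i then f j else 0)"
    for f :: "nat \<Rightarrow> real" and \<omega> i
    using sum.inter_restrict[of "{..<n}" f "K \<omega> - {i}"] sub[of \<omega>] by (simp add: Int_absorb1 subset_iff)
  have card: "real (card (K \<omega>)) = (\<Sum>j<n. if j \<in> K \<omega> then 1 else 0)" for \<omega>
    using K_sum[of "\<lambda>_. 1"] by simp
  show ?thesis
    unfolding im relative_density_image[OF inj fin] card
    unfolding K_sum K_diff_sum by measurable
qed

context
  assumes no_atom: "\<And>x. emeasure U {x} = 0"
begin

text \<open>For a law without atoms the diagonal is a null set by Fubini, and there are only
  countably many pairs of indices.\<close>

lemma AE_inj_X: "AE \<omega> in M. inj (\<lambda>j. X j \<omega>)"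
proof -
  have "AE \<omega> in M. X i \<omega> \<noteq> X j \<omega>" if "i \<noteq> j" for i j
  proof -
    have "AE y in U. fst (x, y) \<noteq> snd (x, y)" for x
      using no_atom[of x] by (intro AE_I[where N="{x}"]) auto
    moreover have "{p \<in> space (U \<Otimes>\<^sub>M U). fst p \<noteq> snd p} \<in> sets (U \<Otimes>\<^sub>M U)"
      by measurable
    ultimately have "AE p in U \<Otimes>\<^sub>M U. fst p \<noteq> snd p"
      by (intro K.P.AE_pair_measure) simp_all
    then show ?thesis
      unfolding distr_pair[OF that, symmetric] by (subst (asm) AE_distr_iff) auto
  qed
  then have "AE \<omega> in M. i \<noteq> j \<longrightarrow> X i \<omega> \<noteq> X j \<omega>" for i j
    by (cases "i = j") auto
  then have "AE \<omega> in M. \<forall>i j. i \<noteq> j \<longrightarrow> X i \<omega> \<noteq> X j \<omega>"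
    unfolding AE_all_countable by blast
  then show ?thesis
    by eventually_elim (auto simp: inj_def)
qed

lemma AE_relative_density_eq:
  "AE \<omega> in M. relative_density (proximity_digraph N ((\<lambda>j. X j \<omega>) ` {..<n}))
    = (\<Sum>i<n. \<Sum>j\<in>{..<n}-{i}. indicator (N (X i \<omega>)) (X j \<omega>)) / (real n * (real n - 1))"
  using AE_inj_X
proof eventually_elim
  case (elim \<omega>)
  then have "inj_on (\<lambda>j. X j \<omega>) {..<n}" by (rule inj_on_subset) simp
  from relative_density_image[OF this] show ?case by simp
qed

lemma expectation_relative_density:
  assumes "2 \<le> n"
  shows "integrable M (\<lambda>\<omega>. relative_density (proximity_digraph N ((\<lambda>j. X j \<omega>) ` {..<n})))" (is "integrable M ?\<rho>")
    and "expectation (\<lambda>\<omega>. relative_density (proximity_digraph N ((\<lambda>j. X j \<omega>) ` {..<n}))) = arc_prob U N"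
proof -
  let ?V = "\<lambda>\<omega>. (\<Sum>i<n. \<Sum>j\<in>{..<n}-{i}. indicator (N (X i \<omega>)) (X j \<omega>)) / (real n * (real n - 1))"
  have int: "integrable M (\<lambda>\<omega>. indicator (N (X i \<omega>)) (X j \<omega>) :: real)" for i j
    by (intro integrable_const_bound[where B=1]) (auto split: split_indicator)
  then have "integrable M ?V" by auto
  moreover have [measurable]: "?V \<in> borel_measurable M" by measurable
  ultimately show "integrable M ?\<rho>"
    using AE_relative_density_eq[of n]
    by (subst integrable_cong_AE[OF relative_density_measurable]) auto
  have "expectation ?\<rho> = expectation ?V"
    by (intro integral_cong_AE relative_density_measurable AE_relative_density_eq) simp
  also have "\<dots> = (\<Sum>i<n. \<Sum>j\<in>{..<n}-{i}. expectation (\<lambda>\<omega>. indicator (N (X i \<omega>)) (X j \<omega>))) / (real n * (real n - 1))"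
    using int by (simp add: Bochner_Integration.integral_sum)
  also have "\<dots> = (\<Sum>i<n. \<Sum>j\<in>{..<n}-{i}. arc_prob U N) / (real n * (real n - 1))"
    by (intro arg_cong[where f="\<lambda>s. s / _"] sum.cong refl expectation_indicator_arc) auto
  also have "\<dots> = arc_prob U N"
    using assms by (simp add: of_nat_diff)
  finally show "expectation ?\<rho> = arc_prob U N" .
qed

lemma relative_density_clt:
  assumes "0 < arc_cov U N"
  shows "weak_conv_m
    (\<lambda>n. distr M borel (\<lambda>\<omega>. sqrt (real n) *
      (relative_density (proximity_digraph N ((\<lambda>j. X j \<omega>) ` {..<n})) - arc_prob U N)))
    (density lborel (normal_density 0 (sqrt (4 * arc_cov U N))))"
proof -
  have "weak_conv_m
    (\<lambda>n. distr M borel (\<lambda>\<omega>. sqrt (real n) *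
      ((\<Sum>i<n. \<Sum>j\<in>{..<n}-{i}. sym_arc N (X i \<omega>) (X j \<omega>)) / (real n * (real n - 1)) - arc_prob U N)))
    (density lborel (normal_density 0 (sqrt (4 * arc_cov U N))))"
    using U_statistic_clt[OF K.sym_arc_measurable sym_arc_commute sym_arc_bound] assms
    by (simp add: K.degree_def[symmetric] K.integral_degree K.arc_cov_eq)
  moreover have "distr M borel (\<lambda>\<omega>. sqrt (real n) *
      ((\<Sum>i<n. \<Sum>j\<in>{..<n}-{i}. sym_arc N (X i \<omega>) (X j \<omega>)) / (real n * (real n - 1)) - arc_prob U N))
    = distr M borel (\<lambda>\<omega>. sqrt (real n) *
      (relative_density (proximity_digraph N ((\<lambda>j. X j \<omega>) ` {..<n})) - arc_prob U N))" for n
  proof (rule distr_cong_AE[OF refl refl])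
    show "AE \<omega> in M. sqrt (real n) *
        ((\<Sum>i<n. \<Sum>j\<in>{..<n}-{i}. sym_arc N (X i \<omega>) (X j \<omega>)) / (real n * (real n - 1)) - arc_prob U N)
      = sqrt (real n) * (relative_density (proximity_digraph N ((\<lambda>j. X j \<omega>) ` {..<n})) - arc_prob U N)"
      using AE_relative_density_eq[of n] by eventually_elim (simp add: sum_sym_arc)
    note relative_density_measurable[measurable]
    show "(\<lambda>\<omega>. sqrt (real n) *
        (relative_density (proximity_digraph N ((\<lambda>j. X j \<omega>) ` {..<n})) - arc_prob U N)) \<in> borel_measurable M"
      by measurable
    show "(\<lambda>\<omega>. sqrt (real n) *
        ((\<Sum>i<n. \<Sum>j\<in>{..<n}-{i}. sym_arc N (X i \<omega>) (X j \<omega>)) / (real n * (real n - 1)) - arc_prob U N))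
      \<in> borel_measurable M"
      unfolding sum_sym_arc by measurable
  qed
  ultimately show ?thesis by simp
qed

end

end

end

section \<open>Reduction to the reference cell\<close>

text \<open>The preimage condition leaves the sign of \<open>s\<close> open, so that both the
  increasing map onto the reference cell and the reflection are covered. Lebesgue measure scales by
  \<bar>s\<bar>, which is also the length of the cell and cancels.\<close>

lemma distr_uniform_measure_affine:
  fixes a b s t :: real
  assumes "a < b" "s \<noteq> 0" "(\<lambda>y. t + s * y) -` {a<..<b} = {0<..<1}"
  shows "distr (uniform_measure lborel {a<..<b}) borel (\<lambda>x. (x - t) / s) = uniform_unit"
proof (rule measure_eqI)
  let ?f = "\<lambda>x. (x - t) / s" and ?g = "\<lambda>y. t + s * y"
  have scale: "emeasure lborel B = ennreal \<bar>s\<bar> * emeasure lborel (?g -` B)" if [measurable]: "B \<in> sets borel" for B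
    by (subst lborel_real_affine[OF assms(2), of t])
       (simp add: emeasure_density nn_integral_cmult nn_integral_distr emeasure_distr)
  have pos: "0 < ennreal \<bar>s\<bar>" "ennreal \<bar>s\<bar> < top"
    using assms(2) by auto
  fix B assume "B \<in> sets (distr (uniform_measure lborel {a<..<b}) borel ?f)"
  then have [measurable]: "B \<in> sets borel" by simp
  have [measurable]: "?f -` B \<in> sets borel"
    using measurable_sets_borel[of ?f borel B] by simp
  have "?g -` ({a<..<b} \<inter> ?f -` B) = {0<..<1} \<inter> B"
    using assms(2,3) by auto
  then have "emeasure lborel ({a<..<b} \<inter> ?f -` B) = ennreal \<bar>s\<bar> * emeasure lborel ({0<..<1} \<inter> B)"
    using scale[of "{a<..<b} \<inter> ?f -` B"] by simp
  moreover have "emeasure lborel {a<..<b} = ennreal \<bar>s\<bar>"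
    using scale[of "{a<..<b}"] assms(3) by simp
  moreover have "ennreal \<bar>s\<bar> * x / ennreal \<bar>s\<bar> = x" for x
    using pos by (metis ennreal_mult_divide_eq less_numeral_extra(3) mult.commute top.not_eq_extremum)
  ultimately show "emeasure (distr (uniform_measure lborel {a<..<b}) borel ?f) B = emeasure uniform_unit B"
    by (simp add: emeasure_distr divide_ennreal_def)
qed simp

lemma measure_uniform_unit:
  assumes "B \<in> sets borel" "{0<..<1} \<inter> B = {l<..<r}" "l \<le> r"
  shows "measure uniform_unit B = r - l"
  using assms by (subst measure_uniform_measure) simp_all

text \<open>An affine function with nonzero slope meets the value \<open>k\<close> at one point,
  whereas the interval has positive length.\<close>

lemma not_AE_constant_if_affine:
  fixes f :: "real \<Rightarrow> real"
  assumes "p < q" "{p<..<q} \<subseteq> {0<..<1}" "\<And>x. p < x \<Longrightarrow> x < q \<Longrightarrow> f x = \<alpha> + \<beta> * x" "\<beta> \<noteq> 0"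
  shows "\<not> (AE x in uniform_unit. f x = k)"
proof
  assume "AE x in uniform_unit. f x = k"
  then have "AE x in lborel. x \<in> {0<..<1} \<longrightarrow> f x = k"
    by (subst (asm) AE_uniform_measure) simp_all
  moreover have "AE x in lborel. x \<noteq> (k - \<alpha>) / \<beta>"
    by (rule AE_lborel_singleton)
  ultimately have "AE x in lborel. x \<notin> {p<..<q}"
  proof eventually_elim
    case (elim x)
    show ?case
    proof
      assume "x \<in> {p<..<q}"
      with elim(1) assms have "\<alpha> + \<beta> * x = k" by (metis greaterThanLessThan_iff subsetD)
      with elim(2) \<open>\<beta> \<noteq> 0\<close> show False by (simp add: field_simps)
    qed
  qed
  then have "{p<..<q} \<in> null_sets lborel"
    by (subst AE_iff_null_sets) simp_all
  from null_setsD1[OF this] show False using \<open>p < q\<close> by simp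
qed

lemma prob_space_uniform_unit: "prob_space uniform_unit"
  by (rule prob_space_uniform_measure) simp_all

lemma affine_mem_greaterThanLessThan_iff:
  fixes a L u :: real
  assumes "0 < L"
  shows "a + L * v \<in> {a + L * p<..<a + L * q} \<longleftrightarrow> v \<in> {p<..<q}"
  using assms by simp

lemma cs_region_middle_affine:
  assumes "a < b" "0 < c" "c < 1"
  shows "(y - a) / (b - a) \<in> cs_region_middle 0 1 \<tau> c ((x - a) / (b - a)) \<longleftrightarrow> y \<in> cs_region_middle a b \<tau> c x"
proof -
  define u v L where "u = (x - a) / (b - a)" and "v = (y - a) / (b - a)" and "L = b - a"
  then have L: "0 < L" and x: "x = a + L * u" and y: "y = a + L * v" and b: "b = a + L"
    using assms by simp_all
  \<comment> \<open>Terms such as \<open>u - 0\<close> stay unsimplified so that the right-hand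
    sides agree literally with the unfolded region for \<open>a = 0\<close> and
    \<open>b = 1\<close>.\<close>
  have eqs: "x - \<tau> * (x - a) = a + L * (u - \<tau> * (u - 0))"
    "x + \<tau> * (1 - c) * (x - a) / c = a + L * (u + \<tau> * (1 - c) * (u - 0) / c)"
    "x - c * \<tau> * (b - x) / (1 - c) = a + L * (u - c * \<tau> * (1 - u) / (1 - c))"
    "x + \<tau> * (b - x) = a + L * (u + \<tau> * (1 - u))"
    unfolding x b using assms by (simp_all add: field_simps)
  have unit: "{a<..<b} = {a + L * 0<..<a + L * 1}"
    unfolding b by simp
  have le: "x \<le> a + c * (b - a) \<longleftrightarrow> u \<le> 0 + c * (1 - 0)"
    unfolding x b using L by (simp add: mult.commute)
  have "y \<in> cs_region_middle a b \<tau> c x \<longleftrightarrow> v \<in> cs_region_middle 0 1 \<tau> c u"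
    unfolding cs_region_middle_def eqs le y
    unfolding unit Int_iff if_distrib[of "(\<in>) _"] affine_mem_greaterThanLessThan_iff[OF L] ..
  then show ?thesis by (simp add: u_def v_def)
qed

lemma cs_region_left_end_affine:
  assumes "a < b"
  shows "(y - a) / (b - a) \<in> cs_region_left_end 0 1 \<tau> ((x - a) / (b - a)) \<longleftrightarrow> y \<in> cs_region_left_end a b \<tau> x"
proof -
  define u v L where "u = (x - a) / (b - a)" and "v = (y - a) / (b - a)" and "L = b - a"
  then have L: "0 < L" and x: "x = a + L * u" and y: "y = a + L * v" and b: "b = a + L"
    using assms by simp_all
  have eqs: "x - \<tau> * (b - x) = a + L * (u - \<tau> * (1 - u))" "x + \<tau> * (b - x) = a + L * (u + \<tau> * (1 - u))"
    unfolding x b by (simp_all add: algebra_simps)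
  have unit: "{a<..<b} = {a + L * 0<..<a + L * 1}"
    unfolding b by simp
  have "y \<in> cs_region_left_end a b \<tau> x \<longleftrightarrow> v \<in> cs_region_left_end 0 1 \<tau> u"
    unfolding cs_region_left_end_def eqs y
    unfolding unit Int_iff affine_mem_greaterThanLessThan_iff[OF L] ..
  then show ?thesis by (simp add: u_def v_def)
qed

lemma cs_region_right_end_reflect:
  "- y \<in> cs_region_left_end (- b) (- a) \<tau> (- x) \<longleftrightarrow> y \<in> cs_region_right_end a b \<tau> x"
  unfolding cs_region_left_end_def cs_region_right_end_def by (auto simp: algebra_simps)

text \<open>Negation exchanges the two kinds of end cell. Followed by the affine map of the cell
  \<open>(- b, - a)\<close> it sends the Y-point \<open>a\<close> to 1, the Y-point of the reference
  cell.\<close>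

lemma cs_region_right_end_affine:
  assumes "a < b"
  shows "(y - b) / (a - b) \<in> cs_region_left_end 0 1 \<tau> ((x - b) / (a - b)) \<longleftrightarrow> y \<in> cs_region_right_end a b \<tau> x"
proof -
  have "(z - b) / (a - b) = (- z - - b) / (- a - - b)" for z
    using minus_divide_divide[of "z - b" "a - b"] by simp
  then show ?thesis
    using cs_region_left_end_affine[of "- b" "- a" "- y" \<tau> "- x"] assms
    by (simp add: cs_region_right_end_reflect)
qed

lemma proximity_kernel_middle: "proximity_kernel uniform_unit (cs_region_middle 0 1 \<tau> c)"
proof -
  interpret prob_space uniform_unit by (rule prob_space_uniform_unit)
  show ?thesis
  proof
    \<comment> \<open>Membership in the conditional region becomes a conjunction of implications
      between inequalities in the two coordinates.\<close>
    have "Measurable.pred (borel \<Otimes>\<^sub>M borel) (\<lambda>p. snd p \<in> cs_region_middle 0 1 \<tau> c (fst p))"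
      unfolding cs_region_middle_def Int_iff if_distrib[of "(\<in>) _"] greaterThanLessThan_iff
        if_bool_eq_conj by measurable
    then show "{p. snd p \<in> cs_region_middle 0 1 \<tau> c (fst p)} \<in> sets (borel \<Otimes>\<^sub>M borel)"
      by (simp add: pred_def space_pair_measure)
  qed simp
qed

lemma proximity_kernel_left_end: "proximity_kernel uniform_unit (cs_region_left_end 0 1 \<tau>)"
proof -
  interpret prob_space uniform_unit by (rule prob_space_uniform_unit)
  show ?thesis
  proof
    have "Measurable.pred (borel \<Otimes>\<^sub>M borel) (\<lambda>p. snd p \<in> cs_region_left_end 0 1 \<tau> (fst p))"
      unfolding cs_region_left_end_def Int_iff greaterThanLessThan_iff by measurable
    then show "{p. snd p \<in> cs_region_left_end 0 1 \<tau> (fst p)} \<in> sets (borel \<Otimes>\<^sub>M borel)"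
      by (simp add: pred_def space_pair_measure)
  qed simp
qed

section \<open>Positivity of the asymptotic variance\<close>

text \<open>\<open>l\<close>, \<open>r\<close> bound the region of \<open>x\<close>, and
  \<open>l'\<close>, \<open>r'\<close> the set of points whose region contains \<open>x\<close>. The
  projection is half the sum of the two lengths, so affinity is asked of this sum alone.\<close>

lemma arc_cov_pos_if_affine:
  assumes "proximity_kernel uniform_unit N" and pq: "0 \<le> p" "p < q" "q \<le> 1" and "\<beta> \<noteq> 0"
    and out_iff: "\<And>x y. p < x \<Longrightarrow> x < q \<Longrightarrow> 0 < y \<Longrightarrow> y < 1 \<Longrightarrow> y \<in> N x \<longleftrightarrow> l x < y \<and> y < r x"
    and out_bounds: "\<And>x. p < x \<Longrightarrow> x < q \<Longrightarrow> 0 \<le> l x \<and> l x \<le> r x \<and> r x \<le> 1"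
    and in_iff: "\<And>x y. p < x \<Longrightarrow> x < q \<Longrightarrow> 0 < y \<Longrightarrow> y < 1 \<Longrightarrow> x \<in> N y \<longleftrightarrow> l' x < y \<and> y < r' x"
    and in_bounds: "\<And>x. p < x \<Longrightarrow> x < q \<Longrightarrow> 0 \<le> l' x \<and> l' x \<le> r' x \<and> r' x \<le> 1"
    and affine: "\<And>x. (r x - l x) + (r' x - l' x) = \<alpha> + \<beta> * x"
  shows "0 < arc_cov uniform_unit N"
proof -
  interpret proximity_kernel uniform_unit N by fact
  have "degree x = \<alpha> / 2 + \<beta> / 2 * x" if x: "p < x" "x < q" for x
  proof -
    have [measurable]: "Measurable.pred (borel \<Otimes>\<^sub>M borel) (\<lambda>p. snd p \<in> N (fst p))"
      using arcs_measurable by (simp add: pred_def space_pair_measure)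
    have meas: "{y. y \<in> N x} \<in> sets borel" "{y. x \<in> N y} \<in> sets borel"
      using measurable_compose[of "\<lambda>y. (x, y)" borel "borel \<Otimes>\<^sub>M borel" "\<lambda>p. snd p \<in> N (fst p)" "count_space UNIV"]
        measurable_compose[of "\<lambda>y. (y, x)" borel "borel \<Otimes>\<^sub>M borel" "\<lambda>p. snd p \<in> N (fst p)" "count_space UNIV"]
      by (simp_all add: pred_def)
    moreover have "{0<..<1} \<inter> {y. y \<in> N x} = {l x<..<r x}" "{0<..<1} \<inter> {y. x \<in> N y} = {l' x<..<r' x}"
      using out_iff[OF x] out_bounds[OF x] in_iff[OF x] in_bounds[OF x] by auto
    ultimately have "measure uniform_unit {y. y \<in> N x} = r x - l x"
        "measure uniform_unit {y. x \<in> N y} = r' x - l' x"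
      using out_bounds[OF x] in_bounds[OF x] by (auto intro!: measure_uniform_unit)
    then show ?thesis
      using affine[of x] degree_eq[OF meas] by (simp add: field_simps)
  qed
  then show ?thesis
    using pq \<open>\<beta> \<noteq> 0\<close>
    by (intro arc_cov_pos not_AE_constant_if_affine[where p=p and q=q and \<alpha>="\<alpha> / 2" and \<beta>="\<beta> / 2"]) auto
qed

text \<open>Next to the Y-point 0 the region of \<open>x\<close> ends at multiples of
  \<open>x\<close>, up to clipping at 0. Inverting the region bounds gives the points that reach
  \<open>x\<close>: for \<tau> < 1 they all lie below \<open>c\<close>, for \<tau> \<ge> 1 they
  extend past it. The slope is positive in both cases.\<close>

lemma cs_nu_pos:
  assumes c: "0 < c" "c < 1" and "0 < \<tau>"
  shows "0 < cs_nu \<tau> c"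
proof -
  \<comment> \<open>\<open>A\<close> is the slope of the upper end in the first branch,
    \<open>k\<close> the coefficient of \<open>1 - x\<close> in the lower end of the second.\<close>
  define A k where "A = 1 + \<tau> * (1 - c) / c" and "k = c * \<tau> / (1 - c)"
  have A: "1 < A" and k: "0 < k"
    using assms by (simp_all add: A_def k_def)
  have region1: "y \<in> cs_region_middle 0 1 \<tau> c x \<longleftrightarrow> x * (1 - \<tau>) < y \<and> y < A * x \<and> 0 < y \<and> y < 1"
    if "x \<le> c" for x y
    using that by (auto simp: cs_region_middle_def A_def algebra_simps)
  have region2: "y \<in> cs_region_middle 0 1 \<tau> c x \<longleftrightarrow> x - k * (1 - x) < y \<and> y < x + \<tau> * (1 - x) \<and> 0 < y \<and> y < 1"
    if "c < x" for x y
    using that by (auto simp: cs_region_middle_def k_def)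
  have below: "x < c" "A * x < 1" "x < 1" if "0 < x" "x < c / A" for x
  proof -
    have "A * x < c" using that A by (simp add: field_simps)
    moreover have "x < A * x" using that A by simp
    ultimately show "x < c" "A * x < 1" "x < 1" using c by linarith+
  qed
  have pos: "0 < c / A" "c / A \<le> 1"
    using c A by (simp_all add: field_simps)
  show ?thesis
  proof (cases "\<tau> < 1")
    case True
    have "c - k * (1 - c) = c * (1 - \<tau>)"
      using c by (simp add: k_def field_simps)
    then have far: "x < y - k * (1 - y)" if "c < y" "x < c * (1 - \<tau>)" for x y
    proof -
      have "k * (1 - y) < k * (1 - c)" using that k by simp
      with that show ?thesis using \<open>c - k * (1 - c) = c * (1 - \<tau>)\<close> by linarith
    qed
    \<comment> \<open>Below \<open>c / A\<close> the upper end \<open>A * x\<close> stays in the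
      cell. The lower end at the division point is \<open>c * (1 - \<tau>)\<close> and increases
      from there, so no point beyond \<open>c\<close> has a region reaching down to a smaller
      \<open>x\<close>.\<close>
    define q where "q = min (c / A) (c * (1 - \<tau>))"
    have q: "0 < q" "q \<le> c / A" "q \<le> c * (1 - \<tau>)"
      using pos c True by (auto simp: q_def)
    show ?thesis
      unfolding cs_nu_def
    proof (rule arc_cov_pos_if_affine[OF proximity_kernel_middle, where p=0 and q=q and \<alpha>=0
          and \<beta>="A - (1 - \<tau>) + (1 / (1 - \<tau>) - 1 / A)" and l="\<lambda>x. x * (1 - \<tau>)" and r="\<lambda>x. A * x"
          and l'="\<lambda>x. x / A" and r'="\<lambda>x. x / (1 - \<tau>)"])
      show "A - (1 - \<tau>) + (1 / (1 - \<tau>) - 1 / A) \<noteq> 0"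
      proof -
        have "1 / A < 1" "1 < 1 / (1 - \<tau>)" using A True \<open>0 < \<tau>\<close> by simp_all
        then show ?thesis using A \<open>0 < \<tau>\<close> by linarith
      qed
      fix x y :: real assume "0 < x" "x < q"
      then have x: "0 < x" "x < c" "A * x < 1" "x < 1" "x < c * (1 - \<tau>)"
        using below[of x] q by auto
      have "0 < x * (1 - \<tau>)" "x * (1 - \<tau>) \<le> x" "x \<le> A * x"
        using x True \<open>0 < \<tau>\<close> A by simp_all
      then show "0 \<le> x * (1 - \<tau>) \<and> x * (1 - \<tau>) \<le> A * x \<and> A * x \<le> 1"
        using x by linarith
      have lim: "x / (1 - \<tau>) < c"
        using x True by (simp add: field_simps)
      have "0 < x / A" "x / A \<le> x" "x \<le> x / (1 - \<tau>)"
        using x A True \<open>0 < \<tau>\<close> by (simp_all add: field_simps)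
      then show "0 \<le> x / A \<and> x / A \<le> x / (1 - \<tau>) \<and> x / (1 - \<tau>) \<le> 1"
        using lim c by linarith
      assume y: "0 < y" "y < 1"
      show "y \<in> cs_region_middle 0 1 \<tau> c x \<longleftrightarrow> x * (1 - \<tau>) < y \<and> y < A * x"
        using x y by (simp add: region1)
      show "x \<in> cs_region_middle 0 1 \<tau> c y \<longleftrightarrow> x / A < y \<and> y < x / (1 - \<tau>)"
      proof (cases "y \<le> c")
        case True
        then show ?thesis
          using region1[OF True] x A \<open>\<tau> < 1\<close> by (auto simp: field_simps)
      next
        case False
        then show ?thesis
          using region2[of y x] far[of y x] lim x by auto
      qed
    qed (use q pos in \<open>auto simp: algebra_simps\<close>)
  next
    case False
    show ?thesis
      unfolding cs_nu_def
    proof (rule arc_cov_pos_if_affine[OF proximity_kernel_middle, where p=0 and q="c / A" and \<alpha>="k / (1 + k)"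
          and \<beta>="A + (1 / (1 + k) - 1 / A)" and l="\<lambda>x. 0" and r="\<lambda>x. A * x"
          and l'="\<lambda>x. x / A" and r'="\<lambda>x. (x + k) / (1 + k)"])
      show "A + (1 / (1 + k) - 1 / A) \<noteq> 0"
      proof -
        have "1 / A < 1" "0 < 1 / (1 + k)" using A k by simp_all
        then show ?thesis using A by linarith
      qed
      fix x y :: real assume "0 < x" "x < c / A"
      note x = this below[OF this]
      show "0 \<le> (0 :: real) \<and> 0 \<le> A * x \<and> A * x \<le> 1"
        using x A by auto
      \<comment> \<open>The upper end (x + k) / (1 + k) solves \<open>y - k * (1 - y) = x\<close>,
        an equation of the second branch, so it has to be located beyond \<open>c\<close>; \<tau>
        \<ge> 1 enters here.\<close>
      have "k * (1 - c) = c * \<tau>" "c * 1 \<le> c * \<tau>"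
        using c False by (auto simp: k_def)
      then have "c * (1 + k) \<le> k"
        by (simp only: algebra_simps)
      then have lim: "c < (x + k) / (1 + k)" "(x + k) / (1 + k) < 1"
        using x k by (simp_all add: field_simps)
      have "0 < x / A" "x / A \<le> x"
        using x A by (simp_all add: field_simps)
      then show "0 \<le> x / A \<and> x / A \<le> (x + k) / (1 + k) \<and> (x + k) / (1 + k) \<le> 1"
        using lim x by linarith
      have nonpos: "z * (1 - \<tau>) \<le> 0" if "0 < z" for z
        using that False by (intro mult_nonneg_nonpos) auto
      assume y: "0 < y" "y < 1"
      show "y \<in> cs_region_middle 0 1 \<tau> c x \<longleftrightarrow> 0 < y \<and> y < A * x"
        using x y nonpos[of x] by (simp add: region1)
      show "x \<in> cs_region_middle 0 1 \<tau> c y \<longleftrightarrow> x / A < y \<and> y < (x + k) / (1 + k)"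
      proof (cases "y \<le> c")
        case True
        have "x < A * y \<longleftrightarrow> x / A < y"
          using A by (simp add: field_simps)
        then show ?thesis
          using region1[OF True, of x] nonpos[OF y(1)] x True lim by linarith
      next
        case False
        have "0 \<le> \<tau> * (1 - y)" using y \<open>0 < \<tau>\<close> by simp
        moreover have "y - k * (1 - y) < x \<longleftrightarrow> y < (x + k) / (1 + k)"
          using k by (simp add: field_simps)
        ultimately show ?thesis
          using region2[of y x] False x \<open>x / A \<le> x\<close> by linarith
      qed
    qed (use pos in \<open>auto simp: algebra_simps add_divide_distrib\<close>)
  qed
qed

text \<open>The reference end cell has its Y-point at 1, so the interval of affinity ends there. The
  slope is negative in both cases.\<close>

lemma cs_nu_end_pos:
  assumes "0 < \<tau>"
  shows "0 < cs_nu_end \<tau>"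
proof -
  have region: "y \<in> cs_region_left_end 0 1 \<tau> x \<longleftrightarrow> x - \<tau> * (1 - x) < y \<and> y < x + \<tau> * (1 - x) \<and> 0 < y \<and> y < 1" for x y
    by (auto simp: cs_region_left_end_def)
  have upper: "x - \<tau> * (1 - x) < y \<longleftrightarrow> x < (y + \<tau>) / (1 + \<tau>)" for x y
    using assms by (simp add: field_simps)
  have upper_less: "x < (x + \<tau>) / (1 + \<tau>)" "(x + \<tau>) / (1 + \<tau>) < 1" if "x < 1" for x
    using assms that by (simp_all add: field_simps)
  \<comment> \<open>The zero of the lower end \<open>x - \<tau> * (1 - x)\<close>; to its right that
    end is not clipped.\<close>
  define p where "p = \<tau> / (1 + \<tau>)"
  have p: "0 < p" "p < 1"
    using assms by (simp_all add: p_def)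
  have lower: "0 < x - \<tau> * (1 - x)" if "p < x" for x
    using assms that by (simp add: p_def field_simps)
  show ?thesis
  proof (cases "\<tau> < 1")
    case True
    \<comment> \<open>Beyond \<tau> the lower end \<open>(x - \<tau>) / (1 - \<tau>)\<close> of the
      set of points reaching \<open>x\<close> is positive as well, hence the maximum of
      \<open>p\<close> and \<tau>.\<close>
    show ?thesis
      unfolding cs_nu_end_def
    proof (rule arc_cov_pos_if_affine[OF proximity_kernel_left_end, where p="max p \<tau>" and q=1
          and \<alpha>="2 * \<tau> + \<tau> / (1 + \<tau>) + \<tau> / (1 - \<tau>)" and \<beta>="- 2 * \<tau> + 1 / (1 + \<tau>) - 1 / (1 - \<tau>)"
          and l="\<lambda>x. x - \<tau> * (1 - x)" and r="\<lambda>x. x + \<tau> * (1 - x)"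
          and l'="\<lambda>x. (x - \<tau>) / (1 - \<tau>)" and r'="\<lambda>x. (x + \<tau>) / (1 + \<tau>)"])
      show "- 2 * \<tau> + 1 / (1 + \<tau>) - 1 / (1 - \<tau>) \<noteq> 0"
      proof -
        have "1 / (1 + \<tau>) < 1" "1 < 1 / (1 - \<tau>)" using True assms by simp_all
        then show ?thesis using assms by linarith
      qed
      fix x y :: real assume "max p \<tau> < x" "x < 1"
      then have x: "p < x" "\<tau> < x" "x < 1" "0 < \<tau> * (1 - x)"
        using assms by auto
      have "x + \<tau> * (1 - x) < x + 1 * (1 - x)"
        using x True by (intro add_strict_left_mono mult_strict_right_mono) auto
      then have "x + \<tau> * (1 - x) < 1" by simp
      then show "0 \<le> x - \<tau> * (1 - x) \<and> x - \<tau> * (1 - x) \<le> x + \<tau> * (1 - x) \<and> x + \<tau> * (1 - x) \<le> 1"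
        using lower[OF x(1)] x by linarith
      have "0 < (x - \<tau>) / (1 - \<tau>)" "(x - \<tau>) / (1 - \<tau>) \<le> x"
        using x True assms by (simp_all add: field_simps)
      then show "0 \<le> (x - \<tau>) / (1 - \<tau>) \<and> (x - \<tau>) / (1 - \<tau>) \<le> (x + \<tau>) / (1 + \<tau>) \<and> (x + \<tau>) / (1 + \<tau>) \<le> 1"
        using upper_less[OF x(3)] by linarith
      assume y: "0 < y" "y < 1"
      show "y \<in> cs_region_left_end 0 1 \<tau> x \<longleftrightarrow> x - \<tau> * (1 - x) < y \<and> y < x + \<tau> * (1 - x)"
        using y by (simp add: region)
      have "x < y + \<tau> * (1 - y) \<longleftrightarrow> (x - \<tau>) / (1 - \<tau>) < y"
        using True by (simp add: field_simps)
      then show "x \<in> cs_region_left_end 0 1 \<tau> y \<longleftrightarrow> (x - \<tau>) / (1 - \<tau>) < y \<and> y < (x + \<tau>) / (1 + \<tau>)"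
        using region[of x y] upper[of y x] x p by linarith
    qed (use p True assms in \<open>auto simp: add_divide_distrib diff_divide_distrib algebra_simps\<close>)
  next
    case False
    show ?thesis
      unfolding cs_nu_end_def
    proof (rule arc_cov_pos_if_affine[OF proximity_kernel_left_end, where p=p and q=1
          and \<alpha>="1 + \<tau> + \<tau> / (1 + \<tau>)" and \<beta>="- (1 + \<tau>) + 1 / (1 + \<tau>)"
          and l="\<lambda>x. x - \<tau> * (1 - x)" and r="\<lambda>x. 1"
          and l'="\<lambda>x. 0" and r'="\<lambda>x. (x + \<tau>) / (1 + \<tau>)"])
      show "- (1 + \<tau>) + 1 / (1 + \<tau>) \<noteq> 0"
      proof -
        have "1 / (1 + \<tau>) < 1" using assms by simp
        then show ?thesis using assms by linarith
      qed
      have beyond: "1 \<le> x + \<tau> * (1 - x)" if "x < 1" for x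
      proof -
        have "x + 1 * (1 - x) \<le> x + \<tau> * (1 - x)"
          using that False by (intro add_left_mono mult_right_mono) auto
        then show ?thesis by simp
      qed
      fix x y :: real assume x: "p < x" "x < 1"
      have "0 < \<tau> * (1 - x)" using x assms by simp
      then show "0 \<le> x - \<tau> * (1 - x) \<and> x - \<tau> * (1 - x) \<le> 1 \<and> 1 \<le> (1 :: real)"
        using lower[OF x(1)] x by linarith
      show "0 \<le> (0 :: real) \<and> 0 \<le> (x + \<tau>) / (1 + \<tau>) \<and> (x + \<tau>) / (1 + \<tau>) \<le> 1"
        using upper_less[OF x(2)] x p by linarith
      assume y: "0 < y" "y < 1"
      show "y \<in> cs_region_left_end 0 1 \<tau> x \<longleftrightarrow> x - \<tau> * (1 - x) < y \<and> y < 1"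
        using region[of y x] beyond[OF x(2)] y by linarith
      show "x \<in> cs_region_left_end 0 1 \<tau> y \<longleftrightarrow> 0 < y \<and> y < (x + \<tau>) / (1 + \<tau>)"
        using region[of x y] upper[of y x] beyond[OF y(2)] x y p by linarith
    qed (use p assms in \<open>auto simp: add_divide_distrib algebra_simps\<close>)
  qed
qed

section \<open>Asymptotic normality\<close>

lemma iid_sample_affine:
  fixes a b s t :: real and X :: "nat \<Rightarrow> 'a \<Rightarrow> real"
  assumes "prob_space M" and indep: "prob_space.indep_vars M (\<lambda>_. borel) X UNIV"
    and distr_X: "\<And>j. distr M borel (X j) = uniform_measure lborel {a<..<b}"
    and ab: "a < b" "s \<noteq> 0" "(\<lambda>y. t + s * y) -` {a<..<b} = {0<..<1}"
  shows "iid_sample M (\<lambda>j \<omega>. (X j \<omega> - t) / s) uniform_unit"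
proof -
  interpret prob_space M by fact
  have [measurable]: "X j \<in> borel_measurable M" for j
    using indep unfolding indep_vars_def2 by simp
  show ?thesis
  proof
    show "indep_vars (\<lambda>_. borel) (\<lambda>j \<omega>. (X j \<omega> - t) / s) UNIV"
      by (rule indep_vars_compose2[OF indep]) simp
    have "distr M borel (\<lambda>\<omega>. (X j \<omega> - t) / s) = distr (distr M borel (X j)) borel (\<lambda>x. (x - t) / s)" for j
      by (subst distr_distr) (auto simp: comp_def)
    then show "distr M borel (\<lambda>\<omega>. (X j \<omega> - t) / s) = uniform_unit" for j
      using distr_uniform_measure_affine[OF ab] by (simp add: distr_X)
  qed
qed

text \<open>Arc indicators are unchanged by the change of variables, so each claim is the reference
  statement for the transformed sample. One statement serves all three kinds of cell.\<close>

lemma density_asymptotics_affine: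
  fixes a b s t :: real and X :: "nat \<Rightarrow> 'a \<Rightarrow> real"
  assumes "prob_space M" and indep: "prob_space.indep_vars M (\<lambda>_. borel) X UNIV"
    and distr_X: "\<And>j. distr M borel (X j) = uniform_measure lborel {a<..<b}"
    and ab: "a < b" "s \<noteq> 0" "(\<lambda>y. t + s * y) -` {a<..<b} = {0<..<1}"
    and equivariant: "\<And>x y. (y - t) / s \<in> N' ((x - t) / s) \<longleftrightarrow> y \<in> N x"
    and kernel: "proximity_kernel uniform_unit N'" and pos: "0 < arc_cov uniform_unit N'"
    and \<rho>: "\<And>n \<omega>. \<rho> n \<omega> = relative_density (proximity_digraph N ((\<lambda>j. X j \<omega>) ` {..<n}))"
  shows "measure M {\<omega> \<in> space M. X 2 \<omega> \<in> N (X 1 \<omega>)} = arc_prob uniform_unit N' \<and>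
    (\<forall>n\<ge>2. integrable M (\<rho> n) \<and> (LINT \<omega>|M. \<rho> n \<omega>) = arc_prob uniform_unit N') \<and>
    covariance M (\<lambda>\<omega>. sym_arc N (X 1 \<omega>) (X 2 \<omega>)) (\<lambda>\<omega>. sym_arc N (X 1 \<omega>) (X 3 \<omega>))
      = arc_cov uniform_unit N' \<and>
    weak_conv_m (\<lambda>n. distr M borel (\<lambda>\<omega>. sqrt (real n) * (\<rho> n \<omega> - arc_prob uniform_unit N')))
      (density lborel (normal_density 0 (sqrt (4 * arc_cov uniform_unit N'))))"
proof -
  define f where "f x = (x - t) / s" for x
  interpret iid_sample M "\<lambda>j \<omega>. f (X j \<omega>)" uniform_unit
    unfolding f_def by (rule iid_sample_affine[OF assms(1-6)])
  have f_iff: "f y \<in> N' (f x) \<longleftrightarrow> y \<in> N x" for x y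
    using equivariant by (simp add: f_def)
  have "inj f"
    using ab(2) by (auto simp: f_def inj_def)
  have \<rho>': "\<rho> n \<omega> = relative_density (proximity_digraph N' ((\<lambda>j. f (X j \<omega>)) ` {..<n}))" for n \<omega>
    using relative_density_equivariant[of f N' N "(\<lambda>j. X j \<omega>) ` {..<n}", OF \<open>inj f\<close> f_iff]
    by (simp add: \<rho> image_image)
  have sym_arc: "sym_arc N x y = sym_arc N' (f x) (f y)" for x y
    by (simp add: sym_arc_def indicator_def f_iff)
  have "emeasure uniform_unit {x} = 0" for x
    using emeasure_eq_0[of "{x}" lborel "{0<..<1} \<inter> {x}"] by simp
  note density = expectation_relative_density[OF kernel this] relative_density_clt[OF kernel this pos]
  show ?thesis
    using arc_probability[OF kernel, of 1 2] covariance_sym_arc[OF kernel, of 1 2 3] density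
    by (simp add: f_iff sym_arc \<rho>'[abs_def])
qed

lemma ordered_point_less:
  assumes "\<delta>1 < \<delta>2" "finite Y" "Y \<subseteq> {\<delta>1<..<\<delta>2}" "1 \<le> i" "i \<le> card Y + 1"
  shows "ordered_point \<delta>1 \<delta>2 Y (i - 1) < ordered_point \<delta>1 \<delta>2 Y i"
proof -
  let ?ys = "sorted_list_of_set Y"
  have len: "length ?ys = card Y" and set: "set ?ys = Y"
    using assms(2) by simp_all
  have mem: "\<delta>1 < ?ys ! k" "?ys ! k < \<delta>2" if "k < card Y" for k
    using nth_mem[of k ?ys] that assms(3) by (auto simp: len set)
  have "?ys ! k < ?ys ! l" if "k < l" "l < card Y" for k l
    using sorted_wrt_nth_less[OF strict_sorted_list_of_set that(1)] that(2) by (simp add: len)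
  then show ?thesis
    using assms(1,4,5) mem unfolding ordered_point_def by auto
qed

text \<open>\<open>X\<close> models the points of one cell given their number: the first
  \<open>n\<close> terms of an iid uniform sequence on that cell. The mean is claimed from two
  points on because division by zero makes the density of fewer points 0. The square root appears
  because \<open>normal_density\<close> takes a standard deviation.\<close>

theorem theorem4p2:
  fixes \<delta>1 \<delta>2 c \<tau> :: real and Y :: "real set" and m i :: nat
    and M :: "'a measure" and X :: "nat \<Rightarrow> 'a \<Rightarrow> real"
  defines "N \<equiv> cs_region \<delta>1 \<delta>2 Y \<tau> c i"
    and "\<rho> \<equiv> (\<lambda>n \<omega>. cs_density \<delta>1 \<delta>2 Y \<tau> c i (\<lambda>j. X j \<omega>) n)"
  assumes "\<delta>1 < \<delta>2"
    and "finite Y" and "card Y = m" and "Y \<subseteq> {\<delta>1<..<\<delta>2}"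
    and "0 < c" and "c < 1"
    and "0 < \<tau>"
    and "prob_space M"
    and "prob_space.indep_vars M (\<lambda>_. borel) X UNIV"
    and "\<And>j. distr M borel (X j) = uniform_measure lborel (cell \<delta>1 \<delta>2 Y i)"
  shows "(i \<in> {2..m} \<longrightarrow>
      measure M {\<omega> \<in> space M. X 2 \<omega> \<in> N (X 1 \<omega>)} = cs_mu \<tau> c \<and>
      (\<forall>n\<ge>2. integrable M (\<rho> n) \<and> (LINT \<omega>|M. \<rho> n \<omega>) = cs_mu \<tau> c) \<and>
      covariance M (\<lambda>\<omega>. sym_arc N (X 1 \<omega>) (X 2 \<omega>)) (\<lambda>\<omega>. sym_arc N (X 1 \<omega>) (X 3 \<omega>))
        = cs_nu \<tau> c \<and>
      weak_conv_m (\<lambda>n. distr M borel (\<lambda>\<omega>. sqrt (real n) * (\<rho> n \<omega> - cs_mu \<tau> c)))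
        (density lborel (normal_density 0 (sqrt (4 * cs_nu \<tau> c))))) \<and>
    (i \<in> {1, m + 1} \<longrightarrow>
      measure M {\<omega> \<in> space M. X 2 \<omega> \<in> N (X 1 \<omega>)} = cs_mu_end \<tau> \<and>
      (\<forall>n\<ge>2. integrable M (\<rho> n) \<and> (LINT \<omega>|M. \<rho> n \<omega>) = cs_mu_end \<tau>) \<and>
      covariance M (\<lambda>\<omega>. sym_arc N (X 1 \<omega>) (X 2 \<omega>)) (\<lambda>\<omega>. sym_arc N (X 1 \<omega>) (X 3 \<omega>))
        = cs_nu_end \<tau> \<and>
      weak_conv_m (\<lambda>n. distr M borel (\<lambda>\<omega>. sqrt (real n) * (\<rho> n \<omega> - cs_mu_end \<tau>)))
        (density lborel (normal_density 0 (sqrt (4 * cs_nu_end \<tau>)))))"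
proof -
  define a b where "a = ordered_point \<delta>1 \<delta>2 Y (i - 1)" and "b = ordered_point \<delta>1 \<delta>2 Y i"
  have ab: "a < b" if "1 \<le> i" "i \<le> m + 1"
    unfolding a_def b_def using assms that by (intro ordered_point_less) auto
  have cell: "cell \<delta>1 \<delta>2 Y i = {a<..<b}"
    by (simp add: cell_def a_def b_def)
  have N: "N = (if i = 1 then cs_region_left_end a b \<tau>
      else if i = m + 1 then cs_region_right_end a b \<tau> else cs_region_middle a b \<tau> c)"
    using assms(5) by (simp add: N_def cs_region_def a_def b_def Let_def)
  have \<rho>: "\<rho> n \<omega> = relative_density (proximity_digraph N ((\<lambda>j. X j \<omega>) ` {..<n}))" for n \<omega>
    by (simp add: \<rho>_def cs_density_def N_def)
  have unit: "(\<lambda>y. a + (b - a) * y) -` {a<..<b} = {0<..<1}"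
    and unit_reflected: "(\<lambda>y. b + (a - b) * y) -` {a<..<b} = {0<..<1}" if "a < b"
  proof -
    have *: "a + (b - a) * y \<in> {a<..<b} \<longleftrightarrow> y \<in> {0<..<1}" for y
      using that affine_mem_greaterThanLessThan_iff[of "b - a" a y 0 1] by simp
    have reflect: "b + (a - b) * y = a + (b - a) * (1 - y)" for y
      by (simp add: algebra_simps)
    have "b + (a - b) * y \<in> {a<..<b} \<longleftrightarrow> y \<in> {0<..<1}" for y
      unfolding reflect * by auto
    with * show "(\<lambda>y. a + (b - a) * y) -` {a<..<b} = {0<..<1}" "(\<lambda>y. b + (a - b) * y) -` {a<..<b} = {0<..<1}"
      unfolding vimage_def by (simp_all only: Collect_mem_eq)
  qed
  have nonzero: "b - a \<noteq> 0" "a - b \<noteq> 0" if "a < b"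
    using that by simp_all
  \<comment> \<open>The map is left open: it starts at \<open>a\<close> with
    \<open>s = b - a\<close> for middle and left end cells, and at \<open>b\<close> with
    \<open>s = a - b\<close> for the right end cell.\<close>
  note asymptotics = density_asymptotics_affine[OF assms(10,11) assms(12)[unfolded cell] _ _ _ _ _ _ \<rho>]
  show ?thesis (is "(_ \<longrightarrow> ?middle) \<and> (_ \<longrightarrow> ?end)")
  proof (rule conjI; rule impI)
    assume i: "i \<in> {2..m}"
    then have "a < b" and N_eq: "N = cs_region_middle a b \<tau> c"
      using ab by (auto simp: N)
    have "(y - a) / (b - a) \<in> cs_region_middle 0 1 \<tau> c ((x - a) / (b - a)) \<longleftrightarrow> y \<in> N x" for x y
      unfolding N_eq using \<open>a < b\<close> assms(7,8) by (rule cs_region_middle_affine)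
    then show ?middle
      unfolding cs_mu_def cs_nu_def using \<open>a < b\<close> cs_nu_pos[OF assms(7-9), unfolded cs_nu_def]
      by (intro asymptotics[where s="b - a" and t=a] nonzero unit proximity_kernel_middle)
  next
    assume "i \<in> {1, m + 1}"
    then have "a < b" using ab by auto
    show ?end
    proof (cases "i = 1")
      case True
      have "(y - a) / (b - a) \<in> cs_region_left_end 0 1 \<tau> ((x - a) / (b - a)) \<longleftrightarrow> y \<in> N x" for x y
        using cs_region_left_end_affine[OF \<open>a < b\<close>] True by (simp add: N)
      then show ?thesis
        unfolding cs_mu_end_def cs_nu_end_def
        using \<open>a < b\<close> cs_nu_end_pos[OF assms(9), unfolded cs_nu_end_def]
        by (intro asymptotics[where s="b - a" and t=a] nonzero unit proximity_kernel_left_end)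
    next
      case False
      then have "(y - b) / (a - b) \<in> cs_region_left_end 0 1 \<tau> ((x - b) / (a - b)) \<longleftrightarrow> y \<in> N x" for x y
        using cs_region_right_end_affine[OF \<open>a < b\<close>] \<open>i \<in> {1, m + 1}\<close> by (simp add: N)
      then show ?thesis
        unfolding cs_mu_end_def cs_nu_end_def
        using \<open>a < b\<close> cs_nu_end_pos[OF assms(9), unfolded cs_nu_end_def]
        by (intro asymptotics[where s="a - b" and t=b] nonzero unit_reflected proximity_kernel_left_end)
    qed
  qed
qed

end
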